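(* Let $g_0$ be an entire function with $g_0(0)=1$. (I) Suppose $g_0$ has no zeros in $\mathbb C$. (i) For every integer $n\ge0$ the set $g_0\mathbb C[z]_n$ is a proper closed $D_{0,g_0}$-invariant subspace of $H(\mathbb C)$. (ii) Every proper closed $D_{0,g_0}$-invariant subspace $S$ of $H(\mathbb C)$ is contained in $g_0\mathbb C[z]$, and $S=g_0\mathbb C[z]_{n(S)}$. (II) Suppose $g_0$ has zeros in $\mathbb C$. (iii) For every nonempty multiple variety $W\prec W(g_0)$ in $\mathbb C$ the set $S(W)$ is a proper closed $D_{0,g_0}$-invariant subspace of $H(\mathbb C)$. (iv) For every polynomial $p\in\mathcal D(g_0)$ and every integer $n\ge0$ with $n\ge\deg(p)-1$, the set $\frac{g_0}{p}\mathbb C[z]_n$ is a proper closed $D_{0,g_0}$-invariant subspace of $H(\mathbb C)$. (v) For every proper closed $D_{0,g_0}$-invariant subspace $S$ of $H(\mathbb C)$, either $S=S(W(S))$, or $S\subset g_0\mathbb C(z)$ and $S=\frac{g_0}{p_S}\mathbb C[z]_{n(S)}$.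
   Context: $H(\mathbb C)$ is the Fréchet space of all entire functions with the topology of compact convergence. The generalized backward shift (Pommiez operator) is the continuous linear operator $D_{0,g_0}:H(\mathbb C)\to H(\mathbb C)$, $D_{0,g_0}(f)(t)=\frac{f(t)-g_0(t)f(0)}{t}$ for $t\ne0$, $D_{0,g_0}(f)(0)=f'(0)-g_0'(0)f(0)$. A subspace of $H(\mathbb C)$ is proper if it is neither $\{0\}$ nor $H(\mathbb C)$. $\mathbb C[z]$ is the set of complex polynomials, $\mathbb C[z]_n$ ($n\ge0$) the set of those of degree at most $n$; the zero polynomial has degree $-\infty$. $\mathbb C(z)$ is the set of rational functions over $\mathbb C$; $S\subset g_0\mathbb C(z)$ means each $f\in S$ has the form $f=g_0R$ with $R$ rational. For a function $h$ and a set of functions $Q$, $hQ:=\{hf\,|\,f\in Q\}$. A multiple variety in $\mathbb C$ is a finite or infinite sequence $W=\{(\lambda_k,m_k)\}$ where the $\lambda_k$ are distinct, $Z(W):=\{\lambda_k\}$ is a discrete subset of $\mathbb C$ and $m_k\in\mathbb N=\{1,2,\dots\}$. For nonempty $W$, $S(W):=\{f\in H(\mathbb C)\,|\,f^{(j)}(\lambda_k)=0,\ 0\le j\le m_k-1,\text{ for all }k\}$; $S(\emptyset):=H(\mathbb C)$. For multiple varieties $W=\{(\lambda,n_\lambda)\}$ and $V=\{(\nu,m_\nu)\}$, $W\prec V$ means $Z(W)\subset Z(V)$ and $n_\lambda\le m_\lambda$ for all $\lambda\in Z(W)$. For an entire function $h$: $Z(h)$ is its set of zeros, $m(\lambda,h)$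 is the multiplicity of the zero $\lambda$ ($0$ if $h(\lambda)\ne0$), $W(h):=\{(\lambda,m(\lambda,h))\,|\,\lambda\in Z(h)\}$ for $h\neq 0$. For $S\subset H(\mathbb C)$, $S\ne\{0\}$: $Z(S):=\bigcap_{h\in S}Z(h)$, $m(\lambda,S):=\min\{m(\lambda,h)\,|\,h\in S\}$ (the zero function being assigned multiplicity $+\infty$), $W(S):=\{(\lambda,m(\lambda,S))\,|\,\lambda\in Z(S)\}$, with $W(S)=\emptyset$ if $Z(S)=\emptyset$. $\mathcal D(g_0)$ is the set of all polynomials $p$ such that $p(0)=1$ and $g_0/p$ is entire. Definition of $p_S$, $n(S)$: let $S\subset g_0\mathbb C(z)$ be a proper closed $D_{0,g_0}$-invariant subspace of $H(\mathbb C)$. Then $p_S$ is the unique polynomial in $\mathcal D(g_0)$ with $W(S)=W(g_0/p_S)$ (so $p_S\equiv1$ if $g_0$ has no zeros). Each $f\in S$ is uniquely written as $f=\frac{g_0}{p_S}r(f)$ with a polynomial $r(f)$, and $n(S):=\sup_{f\in S}\deg r(f)$ (which is finite). *)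

theory Defs
  imports "HOL-Complex_Analysis.Complex_Analysis" "HOL-Library.Extended_Nat"
begin

subsection \<open>The space of entire functions\<close>

definition entire_functions :: "(complex \<Rightarrow> complex) set" where
  "entire_functions = {f. f holomorphic_on UNIV}"

definition compact_nbhd ::
    "complex set \<Rightarrow> real \<Rightarrow> (complex \<Rightarrow> complex) \<Rightarrow> (complex \<Rightarrow> complex) set" where
  "compact_nbhd K e f = {g \<in> entire_functions. \<forall>z\<in>K. dist (f z) (g z) < e}"

text \<open>The topology of compact convergence: the sets \<^term>\<open>compact_nbhd K e f\<close>, for compact
  \<^term>\<open>K\<close> and positive \<^term>\<open>e\<close>, are a neighbourhood base at \<^term>\<open>f\<close>.\<close>

definition entire_topology :: "(complex \<Rightarrow> complex) topology" where
  "entire_topology = topology (\<lambda>U. U \<subseteq> entire_functions \<and>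
     (\<forall>f\<in>U. \<exists>K e. compact K \<and> e > 0 \<and> compact_nbhd K e f \<subseteq> U))"

lemma istopology_entire:
  "istopology (\<lambda>U. U \<subseteq> entire_functions \<and>
     (\<forall>f\<in>U. \<exists>K e. compact K \<and> e > 0 \<and> compact_nbhd K e f \<subseteq> U))"
  unfolding istopology_def
proof (intro conjI allI impI)
  fix U V :: "(complex \<Rightarrow> complex) set"
  assume U: "U \<subseteq> entire_functions \<and>
      (\<forall>f\<in>U. \<exists>K e. compact K \<and> e > 0 \<and> compact_nbhd K e f \<subseteq> U)"
    and V: "V \<subseteq> entire_functions \<and>
      (\<forall>f\<in>V. \<exists>K e. compact K \<and> e > 0 \<and> compact_nbhd K e f \<subseteq> V)"
  show "U \<inter> V \<subseteq> entire_functions" using U by blast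
  show "\<forall>f\<in>U \<inter> V. \<exists>K e. compact K \<and> e > 0 \<and> compact_nbhd K e f \<subseteq> U \<inter> V"
  proof
    fix f assume f: "f \<in> U \<inter> V"
    obtain K d where K: "compact K" "d > 0" "compact_nbhd K d f \<subseteq> U" using U f by blast
    obtain L e where L: "compact L" "e > 0" "compact_nbhd L e f \<subseteq> V" using V f by blast
    have "compact_nbhd (K \<union> L) (min d e) f \<subseteq> compact_nbhd K d f \<inter> compact_nbhd L e f"
      by (auto simp: compact_nbhd_def)
    with K L have "compact (K \<union> L) \<and> min d e > 0 \<and>
        compact_nbhd (K \<union> L) (min d e) f \<subseteq> U \<inter> V"
      by (auto intro: compact_Un)
    then show "\<exists>K e. compact K \<and> e > 0 \<and> compact_nbhd K e f \<subseteq> U \<inter> V" by blast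
  qed
next
  fix \<K> :: "(complex \<Rightarrow> complex) set set"
  assume H: "\<forall>U\<in>\<K>. U \<subseteq> entire_functions \<and>
      (\<forall>f\<in>U. \<exists>K e. compact K \<and> e > 0 \<and> compact_nbhd K e f \<subseteq> U)"
  show "\<Union>\<K> \<subseteq> entire_functions" using H by blast
  show "\<forall>f\<in>\<Union>\<K>. \<exists>K e. compact K \<and> e > 0 \<and> compact_nbhd K e f \<subseteq> \<Union>\<K>"
    using H by (meson Union_iff Union_upper subset_trans)
qed

lemma openin_entire_topology:
  "openin entire_topology U \<longleftrightarrow> U \<subseteq> entire_functions \<and>
     (\<forall>f\<in>U. \<exists>K e. compact K \<and> e > 0 \<and> compact_nbhd K e f \<subseteq> U)"
  unfolding entire_topology_def by (subst topology_inverse'[OF istopology_entire]) (rule refl)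

lemma topspace_entire_topology [simp]: "topspace entire_topology = entire_functions"
proof
  show "topspace entire_topology \<subseteq> entire_functions"
    using openin_entire_topology openin_topspace by blast
  have "openin entire_topology entire_functions"
    unfolding openin_entire_topology
    by (auto simp: compact_nbhd_def intro!: exI[of _ "{}"] exI[of _ "1::real"])
  then show "entire_functions \<subseteq> topspace entire_topology"
    by (rule openin_subset)
qed

definition entire_subspace :: "(complex \<Rightarrow> complex) set \<Rightarrow> bool" where
  "entire_subspace S \<longleftrightarrow> S \<subseteq> entire_functions \<and> (\<lambda>_. 0) \<in> S \<and>
     (\<forall>f\<in>S. \<forall>g\<in>S. (\<lambda>z. f z + g z) \<in> S) \<and> (\<forall>c. \<forall>f\<in>S. (\<lambda>z. c * f z) \<in> S)"

definition pommiez :: "(complex \<Rightarrow> complex) \<Rightarrow> (complex \<Rightarrow> complex) \<Rightarrow> complex \<Rightarrow> complex" where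
  "pommiez g0 f t =
     (if t = 0 then deriv f 0 - deriv g0 0 * f 0 else (f t - g0 t * f 0) / t)"

definition proper_closed_invariant ::
    "(complex \<Rightarrow> complex) \<Rightarrow> (complex \<Rightarrow> complex) set \<Rightarrow> bool" where
  "proper_closed_invariant g0 S \<longleftrightarrow>
     entire_subspace S \<and> S \<noteq> {\<lambda>_. 0} \<and> S \<noteq> entire_functions \<and>
     closedin entire_topology S \<and> pommiez g0 ` S \<subseteq> S"

subsection \<open>Polynomial and rational multiples\<close>

definition fmult ::
    "(complex \<Rightarrow> complex) \<Rightarrow> (complex \<Rightarrow> complex) set \<Rightarrow> (complex \<Rightarrow> complex) set" where
  "fmult h Q = {\<lambda>z. h z * f z | f. f \<in> Q}"

definition polys :: "(complex \<Rightarrow> complex) set" where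
  "polys = range poly"

definition polys_upto :: "nat \<Rightarrow> (complex \<Rightarrow> complex) set" where
  "polys_upto n = {poly p | p. degree p \<le> n}"

text \<open>The entire functions of the form \<open>g0 R\<close> with \<open>R = P / Q\<close> rational. Both sides are
  compared off the zeros of \<open>Q\<close>, where \<open>R\<close> may have poles (cancelled by zeros of \<open>g0\<close>);
  by continuity this determines the entire function.\<close>

definition rational_multiples :: "(complex \<Rightarrow> complex) \<Rightarrow> (complex \<Rightarrow> complex) set" where
  "rational_multiples g0 = {f \<in> entire_functions. \<exists>P Q. Q \<noteq> 0 \<and>
     (\<forall>z. poly Q z \<noteq> 0 \<longrightarrow> f z = g0 z * (poly P z / poly Q z))}"

text \<open>The function \<open>g / p\<close> with its removable singularities removed.\<close>

definition quot :: "(complex \<Rightarrow> complex) \<Rightarrow> complex poly \<Rightarrow> complex \<Rightarrow> complex" where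
  "quot g p = remove_sings (\<lambda>z. g z / poly p z)"

text \<open>At a pole, \<^const>\<open>remove_sings\<close> has the value 0 and is discontinuous, so that the second
  condition holds only if all singularities of \<open>g0 / p\<close> are removable.\<close>

definition entire_denominators :: "(complex \<Rightarrow> complex) \<Rightarrow> complex poly set" where
  "entire_denominators g0 = {p. poly p 0 = 1 \<and> quot g0 p \<in> entire_functions}"

subsection \<open>Multiple varieties\<close>

text \<open>A multiple variety is represented by the set of its pairs; the order of the sequence
  plays no role.\<close>

type_synonym variety = "(complex \<times> nat) set"

definition multiple_variety :: "variety \<Rightarrow> bool" where
  "multiple_variety W \<longleftrightarrow> inj_on fst W \<and> discrete (fst ` W) \<and> (\<forall>(l, m)\<in>W. m \<ge> 1)"

definition variety_space :: "variety \<Rightarrow> (complex \<Rightarrow> complex) set" where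
  "variety_space W = {f \<in> entire_functions. \<forall>(l, m)\<in>W. \<forall>j<m. (deriv ^^ j) f l = 0}"

definition variety_le :: "variety \<Rightarrow> variety \<Rightarrow> bool" where
  "variety_le W V \<longleftrightarrow> fst ` W \<subseteq> fst ` V \<and>
     (\<forall>l n m. (l, n) \<in> W \<and> (l, m) \<in> V \<longrightarrow> n \<le> m)"

definition zero_mult :: "complex \<Rightarrow> (complex \<Rightarrow> complex) \<Rightarrow> enat" where
  "zero_mult l h = (if h = (\<lambda>_. 0) then \<infinity> else enat (nat (zorder h l)))"

definition variety_of_fun :: "(complex \<Rightarrow> complex) \<Rightarrow> variety" where
  "variety_of_fun h = {(l, n). h l = 0 \<and> enat n = zero_mult l h}"

definition zero_mult_set :: "complex \<Rightarrow> (complex \<Rightarrow> complex) set \<Rightarrow> enat" where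
  "zero_mult_set l S = (INF h\<in>S. zero_mult l h)"

definition variety_of_set :: "(complex \<Rightarrow> complex) set \<Rightarrow> variety" where
  "variety_of_set S = {(l, n). (\<forall>h\<in>S. h l = 0) \<and> enat n = zero_mult_set l S}"

subsection \<open>The polynomial \<open>p_S\<close> and the number \<open>n(S)\<close>\<close>

text \<open>These are meaningful only if \<^term>\<open>proper_closed_invariant g0 S\<close> and
  \<^term>\<open>S \<subseteq> rational_multiples g0\<close>.\<close>

definition pS :: "(complex \<Rightarrow> complex) \<Rightarrow> (complex \<Rightarrow> complex) set \<Rightarrow> complex poly" where
  "pS g0 S = (THE p. p \<in> entire_denominators g0 \<and>
     variety_of_set S = variety_of_fun (quot g0 p))"

definition rS ::
    "(complex \<Rightarrow> complex) \<Rightarrow> (complex \<Rightarrow> complex) set \<Rightarrow> (complex \<Rightarrow> complex) \<Rightarrow> complex poly" where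
  "rS g0 S f = (THE r. f = (\<lambda>z. quot g0 (pS g0 S) z * poly r z))"

text \<open>The zero polynomial has \<^const>\<open>degree\<close> 0 rather than minus infinity; this does not affect
  the supremum, because \<open>S\<close> contains a nonzero function.\<close>

definition nS :: "(complex \<Rightarrow> complex) \<Rightarrow> (complex \<Rightarrow> complex) set \<Rightarrow> nat" where
  "nS g0 S = (SUP f\<in>S. degree (rS g0 S f))"

end

(* Hilbert space projection in a weighted l2 norm of the Taylor coefficients separates a closed
   subspace S from a point outside it by a functional of the form f |-> residue at infinity of
   f psi, with psi holomorphic near infinity. Write f psi = omega(f) + G(f) with omega(f) entire and
   G(f) vanishing at infinity. If the functional annihilates the invariant space S, then
   g0 omega(f) = f omega(g0), hence g0 G(f) = f G(g0), for all f in S. If G(g0) vanishes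
   identically, then psi = omega(f) / f for all f in S, and the functional annihilates every function
   whose zeros dominate the common zeros of S. Otherwise f / g0 = G(f) / G(g0) has no poles near
   infinity and polynomial growth there, of an order independent of f, so S consists of polynomial
   multiples of g0 / p. For p of minimal degree the polynomials have no common zero, and a second
   separation argument shows that all powers up to their maximal degree occur. *)
theory Submission
  imports Defs "HOL-Computational_Algebra.Fundamental_Theorem_Algebra"
begin

subsection \<open>Separation in a weighted sequence space\<close>

text \<open>Residues enter because a continuous functional on H(C) has the form f |-> sum of c_n
  a_n, with c_n the Taylor coefficients of f and |a_n| <= B R^n; this sum is the coefficient of 1/z
  in f psi for psi(z) = sum of a_n / z^(n+1). In this form invariance of S becomes an identity
  between entire functions. The obstacle is that g0 need not lie in S: its remainder G(g0) is
  unconstrained, and whether it vanishes separates the two alternatives of (v). If it does not, it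
  has a zero of finite order m at infinity, while each G(f) is bounded there; hence a growth bound
  independent of f. Minimality of p excludes common zeros of the numerators: at a zero of p a common
  factor could be cancelled, elsewhere invariance would force f(0) = 0 for all f in S. For the
  converse statements let e = g0/p. Then e C[z]_n is closed as the kernel of the (n+1)-st power of
  the continuous operator D_{0,e}. It is invariant under D_{0,g0} because a numerator q is sent to
  (q - q(0) p)/z, of degree at most n; here n >= deg p - 1 enters.\<close>

lemma summable_norm_square:
  fixes x :: "nat \<Rightarrow> complex"
  assumes "summable (\<lambda>n. norm (x n))"
  shows "summable (\<lambda>n. (norm (x n))\<^sup>2)"
proof (rule summable_comparison_test_ev[OF _ assms])
  have "(\<lambda>n. norm (x n)) \<longlonglongrightarrow> 0" by (rule summable_LIMSEQ_zero[OF assms])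
  then have "eventually (\<lambda>n. norm (x n) < 1) sequentially"
    by (rule order_tendstoD) simp
  then show "eventually (\<lambda>n. norm ((norm (x n))\<^sup>2) \<le> norm (x n)) sequentially"
    by eventually_elim (simp add: power2_eq_square mult_left_le)
qed

text \<open>The projection of \<open>x0\<close> to the l2-closure of \<open>S\<close> may leave l1,
  so no minimiser is used: the residuals \<open>r k\<close> of a minimising sequence converge
  coordinatewise, and \<open>b\<close> is the conjugate of the limit. Approximate orthogonality to
  \<open>S\<close> passes to the limit because pairing with l1 sequences needs only uniformly
  bounded coordinates.\<close>

lemma l1_separation:
  fixes S :: "(nat \<Rightarrow> complex) set" and x0 :: "nat \<Rightarrow> complex"
  assumes S0: "(\<lambda>_. 0) \<in> S"
    and Sadd: "\<And>x y. x \<in> S \<Longrightarrow> y \<in> S \<Longrightarrow> (\<lambda>n. x n + y n) \<in> S"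
    and Scmul: "\<And>c x. x \<in> S \<Longrightarrow> (\<lambda>n. c * x n) \<in> S"
    and Ssum: "\<And>x. x \<in> S \<Longrightarrow> summable (\<lambda>n. norm (x n))"
    and x0: "summable (\<lambda>n. norm (x0 n))"
    and d: "d > 0" "\<And>x. x \<in> S \<Longrightarrow> d \<le> (\<Sum>n. (norm (x0 n - x n))\<^sup>2)"
  obtains b B where "\<And>n. norm (b n) \<le> B" "\<And>x. x \<in> S \<Longrightarrow> (\<Sum>n. x n * b n) = 0"
    "(\<Sum>n. x0 n * b n) \<noteq> 0"
proof -
  define N where "N x = (\<Sum>n. (norm (x n))\<^sup>2)" for x :: "nat \<Rightarrow> complex"
  define D where "D = (INF x\<in>S. N (\<lambda>n. x0 n - x n))"
  have sumd: "summable (\<lambda>n. norm (x n - y n))"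
    if "summable (\<lambda>n. norm (x n))" "summable (\<lambda>n. norm (y n))" for x y :: "nat \<Rightarrow> complex"
    by (rule summable_comparison_test[OF _ summable_add[OF that]]) (auto simp: norm_triangle_ineq4)
  have bdd: "bdd_below ((\<lambda>x. N (\<lambda>n. x0 n - x n)) ` S)"
    by (rule bdd_belowI[of _ 0]) (auto simp: N_def intro!: suminf_nonneg summable_norm_square sumd[OF x0 Ssum])
  have Dle: "D \<le> N (\<lambda>n. x0 n - x n)" if "x \<in> S" for x
    unfolding D_def by (rule cINF_lower[OF bdd that])
  have Dd: "d \<le> D" unfolding D_def by (rule cINF_greatest) (use S0 d in \<open>auto simp: N_def\<close>)
  have "\<exists>x\<in>S. N (\<lambda>n. x0 n - x n) < D + 1 / real (Suc k)" for k
  proof (rule ccontr)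
    assume "\<not> ?thesis"
    then have "D + 1 / real (Suc k) \<le> D"
      unfolding D_def by (intro cINF_greatest) (use S0 in \<open>auto simp: D_def not_less\<close>)
    then show False by simp
  qed
  then obtain s where s: "\<And>k. s k \<in> S" "\<And>k. N (\<lambda>n. x0 n - s k n) < D + 1 / real (Suc k)"
    by metis
  define r where "r k n = x0 n - s k n" for k n
  have rsum: "summable (\<lambda>n. norm (r k n))" for k
    unfolding r_def by (intro sumd x0 Ssum s)
  have Nr: "N (r k) < D + 1 / real (Suc k)" for k using s(2)[of k] by (simp add: r_def[abs_def])
  have NrD: "D \<le> N (\<lambda>n. r k n - x n)" if "x \<in> S" for k x
    using Dle[OF Sadd[OF s(1)[of k] that]] by (simp add: r_def algebra_simps)
  have coord: "(norm (x n))\<^sup>2 \<le> N x" if "summable (\<lambda>n. norm (x n))" for x n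
    unfolding N_def using sum_le_suminf[OF summable_norm_square[OF that], of "{n}"] by simp
  have N_nonneg: "0 \<le> N x" if "summable (\<lambda>n. norm (x n))" for x
    using coord[OF that, of 0] by (smt (verit) zero_le_power2)
  have par: "N (\<lambda>n. x n - y n) + N (\<lambda>n. x n + y n) = 2 * N x + 2 * N y"
    if "summable (\<lambda>n. norm (x n))" "summable (\<lambda>n. norm (y n))" for x y
  proof -
    have s1: "summable (\<lambda>n. norm (x n + y n))"
      using sumd[OF that(1), of "\<lambda>n. - y n"] that(2) by simp
    have "N (\<lambda>n. x n - y n) + N (\<lambda>n. x n + y n)
        = (\<Sum>n. (norm (x n - y n))\<^sup>2 + (norm (x n + y n))\<^sup>2)"
      unfolding N_def by (intro suminf_add summable_norm_square sumd s1 that)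
    also have "\<dots> = (\<Sum>n. 2 * (norm (x n))\<^sup>2 + 2 * (norm (y n))\<^sup>2)"
      by (rule suminf_cong) (simp add: cmod_power2 power2_sum power2_diff)
    also have "\<dots> = 2 * N x + 2 * N y"
      unfolding N_def using summable_norm_square[OF that(1)] summable_norm_square[OF that(2)]
      by (simp add: suminf_add[symmetric] suminf_mult summable_mult)
    finally show ?thesis .
  qed
  have Nscale: "N (\<lambda>n. c * x n) = (norm c)\<^sup>2 * N x" if "summable (\<lambda>n. norm (x n))" for c x
    unfolding N_def norm_mult power_mult_distrib
    by (rule suminf_mult[OF summable_norm_square[OF that]])
  \<comment> \<open>The midpoint of \<open>s k\<close> and \<open>s l\<close> lies in
    \<open>S\<close>, so the mean of the two residuals has square norm at least \<open>D\<close>;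
    the parallelogram law then bounds their difference.\<close>
  have cau: "(norm (r k n - r l n))\<^sup>2 \<le> 2 / real (Suc k) + 2 / real (Suc l)" for k l n
  proof -
    have "(\<lambda>n. (1/2) * (s k n + s l n)) \<in> S" by (intro Scmul Sadd s)
    then have "D \<le> N (\<lambda>n. (1/2) * (r k n + r l n))"
      using Dle[of "\<lambda>n. (1/2) * (s k n + s l n)"] by (simp add: r_def field_simps)
    also have "\<dots> = N (\<lambda>n. r k n + r l n) / 4"
      using Nscale[of "\<lambda>n. r k n + r l n" "1/2"] sumd[OF rsum[of k], of "\<lambda>n. - r l n"] rsum[of l]
      by (simp add: power2_eq_square norm_divide)
    finally have "N (\<lambda>n. r k n - r l n) \<le> 2 / real (Suc k) + 2 / real (Suc l)"
      using par[OF rsum rsum, of k l] Nr[of k] Nr[of l] by simp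
    with coord[OF sumd[OF rsum[of k] rsum[of l]], of n] show ?thesis by simp
  qed
  have "Cauchy (\<lambda>k. r k n)" for n
  proof (rule metric_CauchyI)
    fix e :: real assume e: "e > 0"
    obtain M where M: "real M > 4 / e\<^sup>2" using reals_Archimedean2 by blast
    have Mpos: "real M > 0" using M e by (smt (verit) divide_pos_pos zero_less_power)
    show "\<exists>M. \<forall>m\<ge>M. \<forall>k\<ge>M. dist (r m n) (r k n) < e"
    proof (intro exI[of _ M] allI impI)
      fix m k assume mk: "M \<le> m" "M \<le> k"
      have "2 / real (Suc m) \<le> 2 / real M" "2 / real (Suc k) \<le> 2 / real M"
        using mk Mpos by (auto intro!: divide_left_mono)
      moreover have "4 / real M < e\<^sup>2" using M Mpos e by (simp add: field_simps)
      ultimately have "(norm (r m n - r k n))\<^sup>2 < e\<^sup>2" using cau[of m n k] by linarith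
      then show "dist (r m n) (r k n) < e"
        using e power2_less_imp_less[of "norm (r m n - r k n)" e] by (simp add: dist_norm)
    qed
  qed
  then have "\<forall>n. \<exists>l. (\<lambda>k. r k n) \<longlonglongrightarrow> l"
    using Cauchy_convergent_iff convergent_def by metis
  then obtain l where l: "\<And>n. (\<lambda>k. r k n) \<longlonglongrightarrow> l n" by metis
  define b where "b n = cnj (l n)" for n
  \<comment> \<open>The 1 dominates 1 / (k + 1) and makes \<open>B\<close> at least 1, so that
    square norms below \<open>B\<close> force coordinates below \<open>B\<close>.\<close>
  define B where "B = D + 1"
  have B1: "B \<ge> 1" using Dd d by (simp add: B_def)
  have rB: "norm (r k n) \<le> B" for k n
  proof -
    have "1 / real (Suc k) \<le> 1" by (simp add: divide_simps)
    then have "N (r k) \<le> B" using less_imp_le[OF Nr[of k]] unfolding B_def by linarith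
    then have "(norm (r k n))\<^sup>2 \<le> B" using coord[OF rsum[of k], of n] by linarith
    also have "B \<le> B\<^sup>2" using B1 by (simp add: power2_eq_square)
    finally show ?thesis using B1 power2_le_imp_le[of "norm (r k n)" B] by simp
  qed
  have bB: "norm (b n) \<le> B" for n
    unfolding b_def complex_mod_cnj
    by (rule tendsto_upperbound[OF tendsto_norm[OF l[of n]]]) (use rB in auto)
  define c where "c x k = (\<Sum>n. x n * cnj (r k n))" for x k
  have csum: "summable (\<lambda>n. norm (x n * cnj (r k n)))" if "summable (\<lambda>n. norm (x n))" for x k
    by (rule summable_comparison_test[OF _ summable_mult2[OF that, of B]])
       (auto simp: norm_mult intro!: mult_left_mono rB)
  have clim: "c x \<longlonglongrightarrow> (\<Sum>n. x n * b n)" if "summable (\<lambda>n. norm (x n))" for x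
  proof -
    have "((\<lambda>k. \<Sum>n. x n * cnj (r k n)) \<longlongrightarrow> (\<Sum>n. x n * b n)) sequentially"
    proof (rule tannerys_theorem[where M="\<lambda>n. norm (x n) * B", THEN conjunct2, THEN conjunct2])
      show "((\<lambda>k. x n * cnj (r k n)) \<longlongrightarrow> x n * b n) sequentially" for n
        unfolding b_def by (intro tendsto_intros l)
      show "\<forall>\<^sub>F (n, k) in at_top \<times>\<^sub>F sequentially. norm (x n * cnj (r k n)) \<le> norm (x n) * B"
        by (auto simp: norm_mult intro!: always_eventually mult_left_mono rB)
      show "summable (\<lambda>n. norm (x n) * B)" by (rule summable_mult2[OF that])
    qed auto
    then show ?thesis by (simp add: c_def[abs_def])
  qed
  have cbound: "(norm (c x k))\<^sup>2 \<le> (1 + N x) / real (Suc k)" if x: "x \<in> S" for x k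
  proof -
    note xs = Ssum[OF x]
    \<comment> \<open>The optimal step along \<open>x\<close> would be 1 / N x. Adding 1 keeps it
      defined when N x = 0 and only weakens the constant in the bound.\<close>
    define t where "t = 1 / (1 + N x)"
    have tpos: "t > 0" using N_nonneg[OF xs] by (simp add: t_def)
    define w where "w = of_real t * c x k"
    have vx: "(\<lambda>n. cnj w * x n) \<in> S" by (rule Scmul[OF x])
    have e: "(norm (r k n - cnj w * x n))\<^sup>2 =
        (norm (r k n))\<^sup>2 - 2 * Re (cnj w * (x n * cnj (r k n))) + (norm w)\<^sup>2 * (norm (x n))\<^sup>2" for n
      unfolding cmod_power2 by (simp add: algebra_simps power2_eq_square)
    have "D \<le> N (\<lambda>n. r k n - cnj w * x n)" by (rule NrD[OF vx])
    also have "\<dots> = (\<Sum>n. (norm (r k n))\<^sup>2 - 2 * Re (cnj w * (x n * cnj (r k n))) + (norm w)\<^sup>2 * (norm (x n))\<^sup>2)"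
      unfolding N_def e ..
    also have "\<dots> = N (r k) - 2 * Re (cnj w * c x k) + (norm w)\<^sup>2 * N x"
    proof (rule sums_unique[symmetric])
      have "(\<lambda>n. x n * cnj (r k n)) sums c x k"
        unfolding c_def by (rule summable_sums[OF summable_norm_cancel[OF csum[OF xs]]])
      then have "(\<lambda>n. Re (cnj w * (x n * cnj (r k n)))) sums Re (cnj w * c x k)"
        by (intro sums_Re sums_mult)
      then show "(\<lambda>n. (norm (r k n))\<^sup>2 - 2 * Re (cnj w * (x n * cnj (r k n))) + (norm w)\<^sup>2 * (norm (x n))\<^sup>2)
         sums (N (r k) - 2 * Re (cnj w * c x k) + (norm w)\<^sup>2 * N x)"
        unfolding N_def
        by (rule sums_add[OF sums_diff[OF summable_sums[OF summable_norm_square[OF rsum]] sums_mult]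
              sums_mult[OF summable_sums[OF summable_norm_square[OF xs]]]])
    qed
    also have "Re (cnj w * c x k) = t * (norm (c x k))\<^sup>2"
      unfolding w_def cmod_power2 by (simp add: algebra_simps power2_eq_square)
    also have "(norm w)\<^sup>2 = t\<^sup>2 * (norm (c x k))\<^sup>2"
      unfolding w_def by (simp add: norm_mult power_mult_distrib)
    finally have 1: "2 * (t * (norm (c x k))\<^sup>2) - t * (t * N x) * (norm (c x k))\<^sup>2 \<le> 1 / real (Suc k)"
      using Nr[of k] by (simp add: power2_eq_square mult_ac)
    have "t * N x \<le> 1" using N_nonneg[OF xs] by (simp add: t_def field_simps)
    then have "(t * N x) * (t * (norm (c x k))\<^sup>2) \<le> 1 * (t * (norm (c x k))\<^sup>2)"
      using tpos by (intro mult_right_mono) auto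
    with 1 have "t * (norm (c x k))\<^sup>2 \<le> 1 / real (Suc k)" by argo
    then have "(norm (c x k))\<^sup>2 \<le> (1 / real (Suc k)) / t"
      using tpos by (simp add: pos_le_divide_eq mult_ac)
    also have "\<dots> = (1 + N x) / real (Suc k)" by (simp add: t_def)
    finally show ?thesis .
  qed
  have c0: "(\<lambda>k. c (x k) k) \<longlonglongrightarrow> 0" if x: "\<And>k. x k \<in> S" and C: "\<And>k. N (x k) \<le> C" for x C
  proof -
    have "(\<lambda>k. (1 + C) / real (Suc k)) \<longlonglongrightarrow> 0"
      by (rule LIMSEQ_Suc[OF lim_const_over_n])
    then have "(\<lambda>k. (norm (c (x k) k))\<^sup>2) \<longlonglongrightarrow> 0"
    proof (rule Lim_null_comparison[rotated], intro always_eventually allI)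
      fix k
      have "(norm (c (x k) k))\<^sup>2 \<le> (1 + N (x k)) / real (Suc k)" by (rule cbound[OF x])
      also have "\<dots> \<le> (1 + C) / real (Suc k)" using C[of k] by (intro divide_right_mono) auto
      finally show "norm ((norm (c (x k) k))\<^sup>2) \<le> (1 + C) / real (Suc k)" by simp
    qed
    then have "(\<lambda>k. sqrt ((norm (c (x k) k))\<^sup>2)) \<longlonglongrightarrow> sqrt 0" by (rule tendsto_real_sqrt)
    then show ?thesis by (simp add: tendsto_norm_zero_iff)
  qed
  show thesis
  proof (rule that[of b B])
    show "norm (b n) \<le> B" for n by (rule bB)
    show "(\<Sum>n. x n * b n) = 0" if "x \<in> S" for x
      using LIMSEQ_unique[OF clim[OF Ssum[OF that]] c0[of "\<lambda>_. x" "N x"]] that by simp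
    show "(\<Sum>n. x0 n * b n) \<noteq> 0"
    proof
      assume 0: "(\<Sum>n. x0 n * b n) = 0"
      \<comment> \<open>The pairings of \<open>x0\<close> and of \<open>s k\<close> with
        \<open>r k\<close> differ by N (r k) >= D >= d. Bounded N (s k) makes the second pairing
        tend to 0, so the first cannot.\<close>
      have sN: "N (s k) \<le> 2 * N x0 + 2 * B" for k
      proof -
        have "1 / real (Suc k) \<le> 1" by (simp add: divide_simps)
        then have "N (r k) \<le> B" using less_imp_le[OF Nr[of k]] unfolding B_def by linarith
        moreover have "N (\<lambda>n. x0 n - r k n) \<le> 2 * N x0 + 2 * N (r k)"
          using par[OF x0 rsum[of k]] N_nonneg[of "\<lambda>n. x0 n + r k n"]
            sumd[OF x0, of "\<lambda>n. - r k n"] rsum[of k] by simp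
        ultimately show ?thesis by (simp add: r_def)
      qed
      have "(\<lambda>k. c x0 k - c (s k) k) \<longlonglongrightarrow> 0 - 0"
        by (intro tendsto_diff c0[OF s(1) sN]) (use clim[OF x0] 0 in simp)
      moreover have "norm (c x0 k - c (s k) k) \<ge> d" for k
      proof -
        have pt: "x0 n * cnj (r k n) - s k n * cnj (r k n) = of_real ((norm (r k n))\<^sup>2)" for n
          unfolding complex_norm_square r_def by (simp only: left_diff_distrib)
        have "c x0 k - c (s k) k = (\<Sum>n. x0 n * cnj (r k n) - s k n * cnj (r k n))"
          unfolding c_def
          by (rule suminf_diff[OF summable_norm_cancel[OF csum[OF x0]] summable_norm_cancel[OF csum[OF Ssum[OF s(1)]]]])
        also have "\<dots> = (\<Sum>n. of_real ((norm (r k n))\<^sup>2))"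
          by (simp only: pt)
        also have "\<dots> = of_real (N (r k))"
          unfolding N_def by (rule suminf_of_real[symmetric, OF summable_norm_square[OF rsum]])
        finally have "norm (c x0 k - c (s k) k) = \<bar>N (r k)\<bar>" by simp
        moreover have "N (r k) \<ge> D" using NrD[OF S0, of k] by simp
        ultimately show ?thesis using Dd by linarith
      qed
      then have "d \<le> norm (0 - 0 :: complex)"
        using tendsto_lowerbound[OF tendsto_norm[OF calculation]] by (simp add: always_eventually)
      with d show False by simp
    qed
  qed
qed

subsection \<open>Residues at infinity as functionals on entire functions\<close>

text \<open>\<open>\<omega>\<close> is the entire part of the Laurent expansion of \<open>f \<psi>\<close> at infinity and \<open>l\<close> is its
  coefficient of \<open>1/z\<close>; the functional attached to \<open>\<psi>\<close> sends \<open>f\<close> to \<open>l\<close>.\<close>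

definition laurent_split ::
    "(complex \<Rightarrow> complex) \<Rightarrow> (complex \<Rightarrow> complex) \<Rightarrow> (complex \<Rightarrow> complex) \<Rightarrow> complex \<Rightarrow> bool" where
  "laurent_split \<psi> f \<omega> l \<longleftrightarrow>
     \<omega> holomorphic_on UNIV \<and> ((\<lambda>z. z * (f z * \<psi> z - \<omega> z)) \<longlongrightarrow> l) at_infinity"

lemma tendsto_zero_if_times_self:
  fixes g :: "complex \<Rightarrow> complex"
  assumes "((\<lambda>z. z * g z) \<longlongrightarrow> l) at_infinity"
  shows "(g \<longlongrightarrow> 0) at_infinity"
proof -
  have "((\<lambda>z. inverse z * (z * g z)) \<longlongrightarrow> 0 * l) at_infinity"
    by (intro tendsto_mult assms tendsto_inverse_0)
  moreover have "\<forall>\<^sub>F z in at_infinity. inverse z * (z * g z) = g z"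
    using eventually_not_equal_at_infinity[of 0] by eventually_elim simp
  ultimately show ?thesis by (simp add: filterlim_cong)
qed

lemma laurent_split_tendsto_0:
  assumes "laurent_split \<psi> f \<omega> l"
  shows "((\<lambda>z. f z * \<psi> z - \<omega> z) \<longlongrightarrow> 0) at_infinity"
  by (rule tendsto_zero_if_times_self[where l=l]) (use assms in \<open>simp add: laurent_split_def\<close>)

text \<open>The difference of two entire parts is entire and tends to 0 at infinity, so Liouville's
  theorem applies.\<close>

lemma laurent_split_unique:
  assumes "laurent_split \<psi> f \<omega> l" "\<omega>' holomorphic_on UNIV"
    "((\<lambda>z. f z * \<psi> z - \<omega>' z) \<longlongrightarrow> 0) at_infinity"
  shows "\<omega>' = \<omega>"
proof
  fix z
  have "((\<lambda>z. (f z * \<psi> z - \<omega> z) - (f z * \<psi> z - \<omega>' z)) \<longlongrightarrow> 0 - 0) at_infinity"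
    by (intro tendsto_diff assms laurent_split_tendsto_0[OF assms(1)])
  then have "((\<lambda>z. \<omega>' z - \<omega> z) \<longlongrightarrow> 0) at_infinity" by simp
  moreover have "(\<lambda>z. \<omega>' z - \<omega> z) holomorphic_on UNIV"
    using assms by (auto simp: laurent_split_def intro!: holomorphic_intros)
  ultimately have "\<omega>' z - \<omega> z = 0" by (intro Liouville_weak_0)
  then show "\<omega>' z = \<omega> z" by simp
qed

lemma laurent_split_unique_value:
  assumes "laurent_split \<psi> f \<omega> l" "laurent_split \<psi> f \<omega>' l'"
  shows "l' = l"
proof -
  have "\<omega>' = \<omega>"
    using laurent_split_unique[OF assms(1)] assms(2) laurent_split_tendsto_0[OF assms(2)]
    by (auto simp: laurent_split_def)
  with assms show ?thesis
    unfolding laurent_split_def using tendsto_unique trivial_limit_at_infinity by blast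
qed

lemma divide_less_1_if: "0 < r \<Longrightarrow> r < x \<Longrightarrow> r / x < (1::real)"
  by simp

lemma holomorphic_on_UNIV_if_balls:
  assumes "\<And>r. f holomorphic_on ball 0 r"
  shows "f holomorphic_on (UNIV :: complex set)"
  unfolding holomorphic_on_def
proof
  fix z :: complex
  have "f field_differentiable at z within ball 0 (norm z + 1)"
    using assms[of "norm z + 1"] unfolding holomorphic_on_def by auto
  moreover have "at z within ball 0 (norm z + 1) = at z"
    by (rule at_within_open) auto
  ultimately show "f field_differentiable at z within UNIV" by simp
qed

section \<open>Taylor tails and the entire part of a product with a germ at infinity\<close>

definition taylor_coeff :: "(complex \<Rightarrow> complex) \<Rightarrow> nat \<Rightarrow> complex" where
  "taylor_coeff f n = (deriv ^^ n) f 0 / fact n"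

lemma taylor_sums:
  assumes "f holomorphic_on UNIV"
  shows "(\<lambda>n. taylor_coeff f n * z ^ n) sums f z"
  using holomorphic_power_series[of f 0 "norm z + 1" z] holomorphic_on_subset[OF assms]
  by (simp add: taylor_coeff_def)

lemma taylor_summable_norm:
  assumes "f holomorphic_on UNIV" "r \<ge> 0"
  shows "summable (\<lambda>n. norm (taylor_coeff f n) * r ^ n)"
proof -
  have "summable (\<lambda>n. taylor_coeff f n * (of_real (r + 1)) ^ n)"
    using taylor_sums[OF assms(1)] sums_summable by blast
  then have "summable (\<lambda>n. norm (taylor_coeff f n * of_real r ^ n))"
    by (rule powser_insidea) (use assms in auto)
  then show ?thesis using assms(2) by (simp add: norm_mult norm_power)
qed

lemma geometric_summable_half: "summable (\<lambda>n. C * (1 / 2 :: real) ^ n)"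
  by (intro summable_mult summable_geometric) simp

text \<open>\<open>T n\<close> is the entire part of f(z) / z^(n+1), that is, the case where \<psi>
  is a single negative power. Its bound gains the factor rho^-(n+1) because the powers of z in the
  tail are lowered by n + 1.\<close>

lemma taylor_tail:
  assumes f: "f holomorphic_on UNIV"
  defines "T \<equiv> \<lambda>n z. \<Sum>j. taylor_coeff f (j + Suc n) * z ^ j"
  shows taylor_tail_holomorphic: "T n holomorphic_on UNIV"
    and taylor_tail_split: "f z = (\<Sum>j\<le>n. taylor_coeff f j * z ^ j) + z ^ Suc n * T n z"
    and taylor_tail_bound: "\<And>\<rho>. \<rho> > 0 \<Longrightarrow> norm z \<le> \<rho> \<Longrightarrow>
          norm (T n z) \<le> (\<Sum>n. norm (taylor_coeff f n) * \<rho> ^ n) / \<rho> ^ Suc n"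
proof -
  let ?c = "taylor_coeff f"
  have s1: "summable (\<lambda>j. norm (?c (j + Suc n)) * \<rho> ^ (j + Suc n))" if "\<rho> > 0" for \<rho>
    using taylor_summable_norm[OF f, of \<rho>] that
      summable_iff_shift[of "\<lambda>j. norm (?c j) * \<rho> ^ j" "Suc n"] by simp
  have le: "norm (?c (j + Suc n) * z ^ j) \<le> norm (?c (j + Suc n)) * \<rho> ^ (j + Suc n) / \<rho> ^ Suc n"
    if "\<rho> > 0" "norm z \<le> \<rho>" for z \<rho> j
    using that by (simp add: norm_mult norm_power power_add mult_left_mono power_mono)
  have s2: "summable (\<lambda>j. norm (?c (j + Suc n) * z ^ j))" for z
  proof (rule summable_comparison_test')
    show "summable (\<lambda>j. norm (?c (j + Suc n)) * (norm z + 1) ^ (j + Suc n) / (norm z + 1) ^ Suc n)"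
      by (intro summable_divide s1) (simp add: add_nonneg_pos)
    show "norm (norm (?c (j + Suc n) * z ^ j)) \<le>
        norm (?c (j + Suc n)) * (norm z + 1) ^ (j + Suc n) / (norm z + 1) ^ Suc n" if "j \<ge> 0" for j
      using le[of "norm z + 1" z j] by (simp add: add_nonneg_pos del: power_Suc)
  qed
  have Tsums: "(\<lambda>j. ?c (j + Suc n) * z ^ j) sums T n z" for z
    unfolding T_def by (rule summable_sums[OF summable_norm_cancel[OF s2]])
  show "T n holomorphic_on UNIV"
  proof (rule holomorphic_on_UNIV_if_balls)
    fix r show "T n holomorphic_on ball 0 r"
      by (rule power_series_holomorphic[where a="\<lambda>j. ?c (j + Suc n)"]) (use Tsums in simp)
  qed
  have "(\<lambda>j. z ^ Suc n * (?c (j + Suc n) * z ^ j)) sums (z ^ Suc n * T n z)"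
    by (rule sums_mult[OF Tsums])
  then have "(\<lambda>j. ?c (j + Suc n) * z ^ (j + Suc n)) sums (z ^ Suc n * T n z)"
    by (simp add: power_add mult_ac)
  then have "(\<lambda>j. ?c j * z ^ j) sums (z ^ Suc n * T n z + (\<Sum>j<Suc n. ?c j * z ^ j))"
    by (rule sums_iff_shift[THEN iffD1])
  from sums_unique2[OF taylor_sums[OF f, of z] this]
  show "f z = (\<Sum>j\<le>n. ?c j * z ^ j) + z ^ Suc n * T n z"
    by (simp add: lessThan_Suc_atMost add.commute del: sum.lessThan_Suc)
  show "norm (T n z) \<le> (\<Sum>n. norm (?c n) * \<rho> ^ n) / \<rho> ^ Suc n" if "\<rho> > 0" "norm z \<le> \<rho>" for \<rho>
  proof -
    have "norm (T n z) \<le> (\<Sum>j. norm (?c (j + Suc n) * z ^ j))"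
      unfolding T_def by (rule summable_norm[OF s2])
    also have "\<dots> \<le> (\<Sum>j. norm (?c (j + Suc n)) * \<rho> ^ (j + Suc n) / \<rho> ^ Suc n)"
      by (rule suminf_le[OF le[OF that] s2 summable_divide[OF s1[OF that(1)]]])
    also have "\<dots> = (\<Sum>j. norm (?c (j + Suc n)) * \<rho> ^ (j + Suc n)) / \<rho> ^ Suc n"
      by (rule suminf_divide[OF s1[OF that(1)]])
    also have "(\<Sum>j. norm (?c (j + Suc n)) * \<rho> ^ (j + Suc n)) \<le> (\<Sum>n. norm (?c n) * \<rho> ^ n)"
      using suminf_split_initial_segment[OF taylor_summable_norm[OF f, of \<rho>], of "Suc n"] that(1)
        sum_nonneg[of "{..<Suc n}" "\<lambda>n. norm (?c n) * \<rho> ^ n"]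
      by (simp del: power_Suc sum.lessThan_Suc)
    finally show ?thesis using that by (simp add: divide_right_mono)
  qed
qed

text \<open>Summing the single-power case, the entire part is the series of
  \<open>a n * T n z\<close>. The remainder times z is the sum of a_n c_j / z^(n-j) over j <= n, in
  which only the diagonal j = n survives at infinity.\<close>

lemma laurent_split_exists:
  fixes a :: "nat \<Rightarrow> complex"
  assumes f: "f holomorphic_on UNIV" and R: "R > 0" and a: "\<And>n. norm (a n) \<le> B * R ^ n"
  shows "\<exists>\<omega>. laurent_split (\<lambda>z. \<Sum>n. a n / z ^ Suc n) f \<omega> (\<Sum>n. taylor_coeff f n * a n)"
proof -
  define c where "c = taylor_coeff f"
  define T where "T n z = (\<Sum>j. taylor_coeff f (j + Suc n) * z ^ j)" for n z
  define M where "M \<rho> = (\<Sum>n. norm (taylor_coeff f n) * \<rho> ^ n)" for \<rho> :: real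
  define \<omega> where "\<omega> z = (\<Sum>n. a n * T n z)" for z
  have B: "B \<ge> 0" using order_trans[OF norm_ge_zero a[of 0]] by simp
  have M: "M \<rho> \<ge> 0" if "\<rho> > 0" for \<rho>
    unfolding M_def using that by (intro suminf_nonneg taylor_summable_norm[OF f]) auto
  \<comment> \<open>Radii of at least 2R turn (R / rho)^n into a geometric majorant of ratio 1/2,
    uniform on the disc.\<close>
  have aT: "norm (a n * T n z) \<le> (B * M \<rho> / \<rho>) * (1 / 2) ^ n"
    if "\<rho> \<ge> 2 * R" "norm z \<le> \<rho>" for n z \<rho>
  proof -
    have \<rho>: "\<rho> > 0" using that R by linarith
    have "norm (a n * T n z) \<le> (B * R ^ n) * (M \<rho> / \<rho> ^ Suc n)"
      unfolding norm_mult
      using a taylor_tail_bound[OF f \<rho> that(2), of n] B R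
      by (intro mult_mono) (auto simp: T_def M_def)
    also have "\<dots> = (B * M \<rho> / \<rho>) * (R / \<rho>) ^ n"
      by (simp add: power_divide mult_ac)
    also have "\<dots> \<le> (B * M \<rho> / \<rho>) * (1 / 2) ^ n"
      using R \<rho> that B M[OF \<rho>] by (intro mult_left_mono power_mono) (auto simp: field_simps)
    finally show ?thesis .
  qed
  have hol\<omega>: "\<omega> holomorphic_on UNIV"
  proof (rule holomorphic_on_UNIV_if_balls)
    fix r :: real
    define \<rho> where "\<rho> = max r (2 * R)"
    have ul: "uniform_limit (cball 0 \<rho>) (\<lambda>n z. \<Sum>i<n. a i * T i z) \<omega> sequentially"
      unfolding \<omega>_def
      by (rule Weierstrass_m_test[OF _ geometric_summable_half[of "B * M \<rho> / \<rho>"]])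
         (use aT[of \<rho>] in \<open>auto simp: \<rho>_def\<close>)
    show "\<omega> holomorphic_on ball 0 r"
    proof (rule holomorphic_uniform_sequence[OF open_ball])
      show "(\<lambda>z. \<Sum>i<n. a i * T i z) holomorphic_on ball 0 r" for n
        using taylor_tail_holomorphic[OF f] unfolding T_def
        by (intro holomorphic_intros) (auto intro: holomorphic_on_subset)
      fix x :: complex assume "x \<in> ball 0 r"
      then obtain d where d: "d > 0" "cball x d \<subseteq> ball 0 r"
        using open_contains_cball open_ball by metis
      have "cball x d \<subseteq> cball 0 \<rho>" using d(2) by (auto simp: \<rho>_def subset_iff)
      then show "\<exists>d>0. cball x d \<subseteq> ball 0 r \<and>
          uniform_limit (cball x d) (\<lambda>n z. \<Sum>i<n. a i * T i z) \<omega> sequentially"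
        using d uniform_limit_on_subset[OF ul] by blast
    qed
  qed
  have key: "z * (f z * (\<Sum>n. a n / z ^ Suc n) - \<omega> z) = (\<Sum>n. a n * (\<Sum>j\<le>n. c j / z ^ (n - j)))"
    if z: "norm z > R" for z
  proof -
    have z0: "z \<noteq> 0" using z R by auto
    have "summable (\<lambda>n. (B / norm z) * (R / norm z) ^ n)"
      using divide_less_1_if[OF R z] R by (intro summable_mult summable_geometric) simp
    then have "summable (\<lambda>n. a n / z ^ Suc n)"
    proof (rule summable_comparison_test')
      fix n
      have "norm (a n / z ^ Suc n) = norm (a n) / norm z ^ Suc n"
        by (simp add: norm_divide norm_mult norm_power)
      also have "\<dots> \<le> (B * R ^ n) / norm z ^ Suc n"
        by (intro divide_right_mono a) simp
      also have "\<dots> = (B / norm z) * (R / norm z) ^ n"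
        by (simp add: power_divide)
      finally show "norm (a n / z ^ Suc n) \<le> (B / norm z) * (R / norm z) ^ n" .
    qed
    then have 1: "(\<lambda>n. z * (f z * (a n / z ^ Suc n))) sums (z * (f z * (\<Sum>n. a n / z ^ Suc n)))"
      by (intro sums_mult summable_sums)
    have "summable (\<lambda>n. a n * T n z)"
      by (rule summable_comparison_test'[OF geometric_summable_half aT[of "max (norm z) (2 * R)"]]) auto
    then have 2: "(\<lambda>n. z * (a n * T n z)) sums (z * \<omega> z)"
      unfolding \<omega>_def by (intro sums_mult summable_sums)
    have "z * (f z * (a n / z ^ Suc n)) - z * (a n * T n z) = a n * (\<Sum>j\<le>n. c j / z ^ (n - j))" for n
    proof -
      have "f z - z ^ Suc n * T n z = (\<Sum>j\<le>n. c j * z ^ j)"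
        using taylor_tail_split[OF f, of z n] by (simp add: T_def c_def)
      moreover have "z * (f z * (a n / z ^ Suc n)) - z * (a n * T n z)
          = a n * ((f z - z ^ Suc n * T n z) / z ^ n)"
        using z0 by (simp add: field_simps)
      moreover have "(\<Sum>j\<le>n. c j * z ^ j) / z ^ n = (\<Sum>j\<le>n. c j / z ^ (n - j))"
        unfolding sum_divide_distrib using z0 by (intro sum.cong) (auto simp: power_diff)
      ultimately show ?thesis by simp
    qed
    with sums_diff[OF 1 2] show ?thesis
      by (simp add: sums_iff right_diff_distrib)
  qed
  \<comment> \<open>The limit may be taken termwise by dominated convergence; the majorant holds for
    |z| >= 2R.\<close>
  have "((\<lambda>z. \<Sum>n. a n * (\<Sum>j\<le>n. c j / z ^ (n - j))) \<longlongrightarrow> (\<Sum>n. c n * a n)) at_infinity"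
  proof (rule tannerys_theorem[where M="\<lambda>n. (B * M (2 * R)) * (1 / 2) ^ n", THEN conjunct2, THEN conjunct2])
    fix n
    have "((\<lambda>z. c j / z ^ (n - j)) \<longlongrightarrow> (if j = n then c n else 0)) at_infinity" if "j \<le> n" for j
    proof (cases "j = n")
      case False
      then have "((\<lambda>z. c j * inverse z ^ (n - j)) \<longlongrightarrow> c j * 0 ^ (n - j)) at_infinity"
        by (intro tendsto_intros tendsto_inverse_0)
      with False that show ?thesis by (simp add: divide_inverse power_inverse zero_power)
    qed auto
    then have "((\<lambda>z. a n * (\<Sum>j\<le>n. c j / z ^ (n - j))) \<longlongrightarrow>
        a n * (\<Sum>j\<le>n. if j = n then c n else 0)) at_infinity"
      by (intro tendsto_mult tendsto_const tendsto_sum) auto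
    then show "((\<lambda>z. a n * (\<Sum>j\<le>n. c j / z ^ (n - j))) \<longlongrightarrow> c n * a n) at_infinity"
      by (simp add: mult.commute)
  next
    have "norm (a n * (\<Sum>j\<le>n. c j / z ^ (n - j))) \<le> (B * M (2 * R)) * (1 / 2) ^ n"
      if "norm z \<ge> 2 * R" for n z
    proof -
      have zp: "norm z > 0" using that R by linarith
      have "norm (\<Sum>j\<le>n. c j / z ^ (n - j)) \<le> (\<Sum>j\<le>n. norm (c j) * (2 * R) ^ j / (2 * R) ^ n)"
      proof (rule sum_norm_le)
        fix j assume "j \<in> {..n}"
        then have j: "j \<le> n" by simp
        have "norm (c j / z ^ (n - j)) = norm (c j) / norm z ^ (n - j)"
          by (simp add: norm_divide norm_power)
        also have "\<dots> \<le> norm (c j) / (2 * R) ^ (n - j)"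
          using R that zp by (intro divide_left_mono power_mono mult_pos_pos) auto
        also have "\<dots> = norm (c j) * (2 * R) ^ j / (2 * R) ^ n"
          using R j by (simp add: power_diff)
        finally show "norm (c j / z ^ (n - j)) \<le> norm (c j) * (2 * R) ^ j / (2 * R) ^ n" .
      qed
      also have "\<dots> = (\<Sum>j\<le>n. norm (c j) * (2 * R) ^ j) / (2 * R) ^ n"
        by (simp add: sum_divide_distrib)
      also have "\<dots> \<le> M (2 * R) / (2 * R) ^ n"
        unfolding M_def c_def using R
        by (intro divide_right_mono sum_le_suminf taylor_summable_norm[OF f]) auto
      finally have "norm (a n * (\<Sum>j\<le>n. c j / z ^ (n - j))) \<le> (B * R ^ n) * (M (2 * R) / (2 * R) ^ n)"
        unfolding norm_mult using a B R by (intro mult_mono) auto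
      also have "\<dots> = (B * M (2 * R)) * (1 / 2) ^ n"
        using R by (simp add: power_mult_distrib power_divide)
      finally show ?thesis .
    qed
    then show "\<forall>\<^sub>F (n, z) in at_top \<times>\<^sub>F at_infinity.
        norm (a n * (\<Sum>j\<le>n. c j / z ^ (n - j))) \<le> (B * M (2 * R)) * (1 / 2) ^ n"
      unfolding eventually_prod_filter
      by (intro exI[of _ "\<lambda>_. True"] exI[of _ "\<lambda>z. norm z \<ge> 2 * R"])
         (auto simp: eventually_at_infinity)
  qed (use geometric_summable_half trivial_limit_at_infinity in auto)
  moreover have "\<forall>\<^sub>F z in at_infinity. z * (f z * (\<Sum>n. a n / z ^ Suc n) - \<omega> z)
      = (\<Sum>n. a n * (\<Sum>j\<le>n. c j / z ^ (n - j)))"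
    unfolding eventually_at_infinity by (intro exI[of _ "R + 1"]) (auto intro!: key simp del: power_Suc)
  ultimately have "laurent_split (\<lambda>z. \<Sum>n. a n / z ^ Suc n) f \<omega> (\<Sum>n. c n * a n)"
    unfolding laurent_split_def using hol\<omega> by (simp cong: filterlim_cong)
  then show ?thesis unfolding c_def by blast
qed

text \<open>In the coordinate w = 1/z the series is w times a power series converging for |w| <
  1/R.\<close>

lemma holomorphic_series_at_infinity:
  fixes a :: "nat \<Rightarrow> complex"
  assumes R: "R > 0" and a: "\<And>n. norm (a n) \<le> B * R ^ n"
  shows "(\<lambda>z. \<Sum>n. a n / z ^ Suc n) holomorphic_on {z. R < norm z}"
proof -
  define A where "A w = (\<Sum>n. a n * w ^ n)" for w
  have "A holomorphic_on ball 0 (1 / R)"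
  proof (rule power_series_holomorphic[where a=a])
    fix w :: complex assume w: "w \<in> ball 0 (1 / R)"
    then have "summable (\<lambda>n. B * (R * norm w) ^ n)"
      using R by (intro summable_mult summable_geometric) (simp add: field_simps)
    then have "summable (\<lambda>n. a n * w ^ n)"
    proof (rule summable_comparison_test')
      fix n
      show "norm (a n * w ^ n) \<le> B * (R * norm w) ^ n"
        using mult_right_mono[OF a[of n], of "norm w ^ n"]
        by (simp add: norm_mult norm_power power_mult_distrib)
    qed
    then show "(\<lambda>n. a n * (w - 0) ^ n) sums A w" by (simp add: A_def summable_sums)
  qed
  then have "(A \<circ> (\<lambda>z. 1 / z)) holomorphic_on {z. R < norm z}"
    using R by (intro holomorphic_on_compose_gen[where t="ball 0 (1 / R)"] holomorphic_intros)
      (use R in \<open>auto simp: norm_divide intro!: frac_less2\<close>)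
  then have "(\<lambda>z. (1 / z) * A (1 / z)) holomorphic_on {z. R < norm z}"
    using R by (intro holomorphic_intros) (auto simp: o_def)
  moreover have "(1 / z) * A (1 / z) = (\<Sum>n. a n / z ^ Suc n)" if "R < norm z" for z
  proof -
    have "summable (\<lambda>n. a n * (1 / z) ^ n)"
    proof (rule summable_comparison_test'[where g="\<lambda>n. B * (R / norm z) ^ n"])
      show "summable (\<lambda>n. B * (R / norm z) ^ n)"
        using divide_less_1_if[OF R that] R by (intro summable_mult summable_geometric) simp
      show "norm (a n * (1 / z) ^ n) \<le> B * (R / norm z) ^ n" for n
        using mult_right_mono[OF a[of n], of "1 / norm z ^ n"]
        by (simp add: norm_mult norm_power norm_divide power_divide)
    qed
    from suminf_mult[OF this, of "1 / z"] show ?thesis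
      by (simp add: A_def power_divide mult.commute)
  qed
  ultimately show ?thesis by (rule holomorphic_transform) simp
qed

section \<open>Separation of a closed subspace from an entire function\<close>

lemma taylor_coeff_add:
  assumes "f holomorphic_on UNIV" "g holomorphic_on UNIV"
  shows "taylor_coeff (\<lambda>z. f z + g z) n = taylor_coeff f n + taylor_coeff g n"
  using higher_deriv_add[OF assms open_UNIV, of 0 n] by (simp add: taylor_coeff_def add_divide_distrib)

lemma taylor_coeff_cmult:
  assumes "f holomorphic_on UNIV"
  shows "taylor_coeff (\<lambda>z. c * f z) n = c * taylor_coeff f n"
  using higher_deriv_cmult[OF assms UNIV_I open_UNIV, of n c 0] by (simp add: taylor_coeff_def)

lemma entire_iff: "f \<in> entire_functions \<longleftrightarrow> f holomorphic_on UNIV"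
  by (simp add: entire_functions_def)

lemma entire_subspace_diff:
  assumes "entire_subspace S" "f \<in> S" "g \<in> S"
  shows "(\<lambda>z. f z - g z) \<in> S"
proof -
  have "(\<lambda>z. (-1) * g z) \<in> S" using assms by (auto simp only: entire_subspace_def)
  then have "(\<lambda>z. f z + (-1) * g z) \<in> S" using assms by (auto simp only: entire_subspace_def)
  then show ?thesis by simp
qed

text \<open>Some basic neighbourhood of \<open>f0\<close>, given by \<open>K\<close> and
  \<open>e\<close>, misses \<open>S\<close>. If \<open>K\<close> lies in the disc of radius R0,
  weighting the n-th Taylor coefficient by (2 R0)^n gives |h| <= 2q on \<open>K\<close>, with q the
  l2 norm of the weighted coefficients of h. So \<open>f0\<close> has l2 distance at least e/2 from
  \<open>S\<close>, and separation in the sequence space applies.\<close>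

lemma closed_subspace_separation:
  assumes S: "entire_subspace S" "closedin entire_topology S"
    and f0: "f0 \<in> entire_functions" "f0 \<notin> S"
  obtains \<psi> R where "R > 0" "\<psi> holomorphic_on {z. R < norm z}"
    "\<And>f. f \<in> entire_functions \<Longrightarrow> \<exists>\<omega> l. laurent_split \<psi> f \<omega> l"
    "\<And>f. f \<in> S \<Longrightarrow> \<exists>\<omega>. laurent_split \<psi> f \<omega> 0"
    "\<And>\<omega>. \<not> laurent_split \<psi> f0 \<omega> 0"
proof -
  have "openin entire_topology (entire_functions - S)"
    using S(2) openin_diff[OF openin_topspace, of entire_topology S] by simp
  then obtain K e where K: "compact K" "e > 0" "compact_nbhd K e f0 \<subseteq> entire_functions - S"
    unfolding openin_entire_topology using f0 by blast
  obtain R0 where R0: "R0 > 0" "\<And>z. z \<in> K \<Longrightarrow> norm z \<le> R0"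
    using bounded_pos compact_imp_bounded[OF K(1)] by blast
  have SE: "f holomorphic_on UNIV" if "f \<in> S" for f
    using S that by (auto simp: entire_subspace_def entire_functions_def)
  define R where "R = 2 * R0"
  have R: "R > 0" using R0 by (simp add: R_def)
  define X where "X f n = taylor_coeff f n * of_real R ^ n" for f n
  have Xadd: "X (\<lambda>z. f z + g z) = (\<lambda>n. X f n + X g n)"
    if "f holomorphic_on UNIV" "g holomorphic_on UNIV" for f g
    using that by (auto simp: X_def taylor_coeff_add algebra_simps)
  have Xc: "X (\<lambda>z. c * f z) = (\<lambda>n. c * X f n)" if "f holomorphic_on UNIV" for f c
    using that by (auto simp: X_def taylor_coeff_cmult)
  have Xsum: "summable (\<lambda>n. norm (X f n))" if "f holomorphic_on UNIV" for f
    using taylor_summable_norm[OF that, of R] R by (simp add: X_def norm_mult norm_power)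
  have hS: "(e / 2)\<^sup>2 \<le> (\<Sum>n. (norm (X f0 n - X s n))\<^sup>2)" if s: "s \<in> S" for s
  proof -
    define h where "h z = f0 z + (-1) * s z" for z
    have hol: "f0 holomorphic_on UNIV" "s holomorphic_on UNIV" "(\<lambda>z. (-1) * s z) holomorphic_on UNIV"
      using f0 SE[OF s] by (auto simp: entire_iff intro!: holomorphic_intros)
    then have hh: "h holomorphic_on UNIV" unfolding h_def by (intro holomorphic_intros)
    have Xh: "X h = (\<lambda>n. X f0 n - X s n)"
      unfolding h_def using Xadd[OF hol(1,3)] Xc[OF hol(2), of "-1"] by simp
    have "s \<notin> compact_nbhd K e f0" using K s by blast
    then obtain z where z: "z \<in> K" "e \<le> norm (h z)"
      using hol(2) by (auto simp: compact_nbhd_def entire_iff h_def dist_norm not_less)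
    define q where "q = sqrt (\<Sum>n. (norm (X h n))\<^sup>2)"
    have Xq: "norm (X h n) \<le> q" for n
      unfolding q_def using sum_le_suminf[OF summable_norm_square[OF Xsum[OF hh]], of "{n}"]
      by (intro real_le_rsqrt) simp
    have le: "norm (taylor_coeff h n * z ^ n) \<le> q * (1 / 2) ^ n" for n
    proof -
      have "norm (taylor_coeff h n * z ^ n) \<le> norm (taylor_coeff h n) * R0 ^ n"
        unfolding norm_mult norm_power using R0 z by (intro mult_left_mono power_mono) auto
      also have "\<dots> = norm (X h n) * (1 / 2) ^ n"
        using R0 by (simp add: X_def R_def norm_mult norm_power power_mult_distrib power_divide)
      also have "\<dots> \<le> q * (1 / 2) ^ n" by (intro mult_right_mono Xq) simp
      finally show ?thesis .
    qed
    have "norm (\<Sum>n. taylor_coeff h n * z ^ n) \<le> (\<Sum>n. q * (1 / 2) ^ n)"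
      by (rule norm_suminf_le[OF le geometric_summable_half])
    also have "(\<Sum>n. taylor_coeff h n * z ^ n) = h z"
      using taylor_sums[OF hh] by (rule sums_unique[symmetric])
    also have "(\<Sum>n. q * (1 / 2) ^ n) = 2 * q"
      using suminf_mult[OF summable_geometric, of "1/2 :: real" q] by (simp add: suminf_geometric)
    finally have "e / 2 \<le> q" using z by simp
    then have "(e / 2)\<^sup>2 \<le> q\<^sup>2" using K(2) by (intro power_mono) auto
    also have "q\<^sup>2 = (\<Sum>n. (norm (X h n))\<^sup>2)"
      unfolding q_def
      by (intro real_sqrt_pow2 suminf_nonneg summable_norm_square Xsum[OF hh]) auto
    finally show ?thesis by (simp add: Xh)
  qed
  have f0h: "f0 holomorphic_on UNIV" using f0 by (simp add: entire_iff)
  obtain b B where b: "\<And>n. norm (b n) \<le> B" "\<And>x. x \<in> X ` S \<Longrightarrow> (\<Sum>n. x n * b n) = 0"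
    "(\<Sum>n. X f0 n * b n) \<noteq> 0"
  proof (rule l1_separation[of "X ` S" "X f0" "(e / 2)\<^sup>2"])
    have z: "(\<lambda>_. 0) \<in> S" using S by (simp add: entire_subspace_def)
    have "X (\<lambda>_. 0) = (\<lambda>_. 0)" using Xc[of "\<lambda>_. 0" 0] by simp
    with z show "(\<lambda>_. 0) \<in> X ` S" by (metis imageI)
    show "(\<lambda>n. x n + y n) \<in> X ` S" if xy: "x \<in> X ` S" "y \<in> X ` S" for x y
    proof -
      obtain f g where fg: "f \<in> S" "g \<in> S" "x = X f" "y = X g" using xy by auto
      then have "X (\<lambda>z. f z + g z) \<in> X ` S" using S by (auto simp: entire_subspace_def)
      then show ?thesis using Xadd[OF SE[OF fg(1)] SE[OF fg(2)]] fg by simp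
    qed
    show "(\<lambda>n. c * x n) \<in> X ` S" if x: "x \<in> X ` S" for c x
    proof -
      obtain f where fg: "f \<in> S" "x = X f" using x by auto
      then have "X (\<lambda>z. c * f z) \<in> X ` S" using S by (auto simp: entire_subspace_def)
      then show ?thesis using Xc[OF SE[OF fg(1)]] fg by simp
    qed
  qed (use Xsum SE f0h hS K(2) in auto)
  \<comment> \<open>Moving the weight from the function to the functional turns the bounded
    \<open>b\<close> into coefficients of growth R^n, which make \<psi> holomorphic for |z| >
    R.\<close>
  define a where "a n = b n * of_real R ^ n" for n
  have a: "norm (a n) \<le> B * R ^ n" for n
    using mult_right_mono[OF b(1)[of n], of "R ^ n"] R by (simp add: a_def norm_mult norm_power)
  have eq: "(\<Sum>n. taylor_coeff f n * a n) = (\<Sum>n. X f n * b n)" for f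
    by (simp add: a_def X_def mult_ac)
  note ex = laurent_split_exists[OF _ R a]
  show thesis
  proof (rule that[OF R holomorphic_series_at_infinity[OF R a]])
    show "\<exists>\<omega> l. laurent_split (\<lambda>z. \<Sum>n. a n / z ^ Suc n) f \<omega> l" if "f \<in> entire_functions" for f
      using ex[of f] that by (auto simp: entire_iff)
    show "\<exists>\<omega>. laurent_split (\<lambda>z. \<Sum>n. a n / z ^ Suc n) f \<omega> 0" if "f \<in> S" for f
      using ex[OF SE[OF that]] b(2)[of "X f"] that by (simp add: eq)
    show "\<not> laurent_split (\<lambda>z. \<Sum>n. a n / z ^ Suc n) f0 \<omega> 0" for \<omega>
      using ex[OF f0h] b(3) laurent_split_unique_value unfolding eq by metis
  qed
qed

subsection \<open>Multiplicities and divisibility of entire functions\<close>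

text \<open>The zeros of \<open>h\<close> cannot fill a nonempty open set, while the set where
  \<open>X\<close> is nonzero is open. Only continuity on an open set is asked of \<open>X\<close>,
  so that functions defined merely near infinity are covered.\<close>

lemma entire_mult_cancel:
  fixes h X :: "complex \<Rightarrow> complex"
  assumes h: "h holomorphic_on UNIV" "h \<noteq> (\<lambda>_. 0)" and V: "open V" and X: "continuous_on V X"
    and eq: "\<And>z. z \<in> V \<Longrightarrow> h z * X z = 0" and z: "z \<in> V"
  shows "X z = 0"
proof (rule ccontr)
  assume "X z \<noteq> 0"
  have "open (V \<inter> X -` (- {0}))"
    using continuous_open_preimage[OF X V, of "- {0}"] by auto
  moreover have "z \<in> V \<inter> X -` (- {0})" using z \<open>X z \<noteq> 0\<close> by simp
  ultimately obtain U where "open U" "z \<in> U" "\<And>w. w \<in> U \<Longrightarrow> h w = 0"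
    using eq by (metis (no_types, lifting) ComplD IntD1 IntD2 insertI1 mult_eq_0_iff vimageE)
  moreover have "h holomorphic_on UNIV" by fact
  ultimately have "h w = 0" for w
    using analytic_continuation_open[of U UNIV h "\<lambda>_. 0" w] by auto
  with h(2) show False by auto
qed

lemma entire_mult_cancel_left:
  assumes "h holomorphic_on UNIV" "h \<noteq> (\<lambda>_. 0)" "f holomorphic_on UNIV" "g holomorphic_on UNIV"
    and "\<And>z. h z * f z = h z * g z"
  shows "f = g"
proof
  fix z
  have "f z - g z = 0"
    by (rule entire_mult_cancel[OF assms(1,2) open_UNIV])
       (use assms(3-) in \<open>auto intro!: holomorphic_on_imp_continuous_on holomorphic_intros simp: right_diff_distrib\<close>)
  then show "f z = g z" by simp
qed

lemma entire_divide_linear: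
  assumes "f holomorphic_on UNIV" "f a = 0"
  obtains u where "u holomorphic_on UNIV" "\<And>z. f z = (z - a) * u z"
proof -
  define u where "u z = (if z = a then deriv f a else f z / (z - a))" for z
  have "u holomorphic_on UNIV"
    by (rule pole_theorem_open_0[OF assms(1) open_UNIV, where a=a]) (auto simp: u_def assms)
  moreover have "f z = (z - a) * u z" for z using assms(2) by (auto simp: u_def)
  ultimately show thesis by (rule that)
qed


lemma zero_mult_eqI:
  assumes "u holomorphic_on UNIV" "u a \<noteq> 0" "\<And>z. h z = (z - a) ^ m * u z"
  shows "zero_mult a h = enat m"
proof -
  \<comment> \<open>The zero function has multiplicity infinity by definition and must be excluded
    before \<open>zorder\<close> can be used.\<close>
  have "\<exists>z. h z \<noteq> 0"
  proof (rule ccontr)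
    assume "\<not> ?thesis"
    then have "(z - a) ^ m * u z = 0" for z using assms(3) by simp
    moreover have "(\<lambda>z. (z - a) ^ m) \<noteq> (\<lambda>_. 0)"
      by (metis add_diff_cancel_right' one_neq_zero power_one)
    ultimately have "u a = 0"
      by (intro entire_mult_cancel[of "\<lambda>z. (z - a) ^ m" UNIV u a])
         (use assms(1) in \<open>auto intro!: holomorphic_intros holomorphic_on_imp_continuous_on\<close>)
    with assms(2) show False by simp
  qed
  then have "h \<noteq> (\<lambda>_. 0)" by auto
  moreover have "zorder h a = int m"
    by (rule zorder_eqI[OF open_UNIV UNIV_I assms(1,2)]) (simp add: assms(3) mult.commute)
  ultimately show ?thesis by (simp add: zero_mult_def)
qed

lemma zero_mult_factor:
  assumes h: "h holomorphic_on UNIV" "h \<noteq> (\<lambda>_. 0)"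
  obtains m u where "zero_mult a h = enat m" "u holomorphic_on UNIV" "u a \<noteq> 0"
    "\<And>z. h z = (z - a) ^ m * u z"
proof -
  have "\<exists>w\<in>UNIV. h w \<noteq> 0" using h(2) by auto
  from zorder_exist_zero[OF h(1) open_UNIV connected_UNIV UNIV_I this, of a]
  obtain r g m where g: "r > 0" "g holomorphic_on cball a r"
    "\<And>w. w \<in> cball a r \<Longrightarrow> h w = g w * (w - a) ^ m" "\<And>w. w \<in> cball a r \<Longrightarrow> g w \<noteq> 0"
    by blast
  define u where "u z = (if z = a then g a else h z / (z - a) ^ m)" for z
  have ug: "u w = g w" if "w \<in> cball a r" for w
    using g(3)[OF that] by (auto simp: u_def)
  have "u holomorphic_on ball a r \<union> - {a}"
  proof (rule holomorphic_on_Un)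
    have "g holomorphic_on ball a r" using g(2) by (rule holomorphic_on_subset) auto
    then show "u holomorphic_on ball a r" by (rule holomorphic_transform) (simp add: ug)
    have "(\<lambda>z. h z / (z - a) ^ m) holomorphic_on - {a}"
      using h(1) by (intro holomorphic_intros) (auto intro: holomorphic_on_subset)
    then show "u holomorphic_on - {a}" by (rule holomorphic_transform) (auto simp: u_def)
  qed auto
  also have "ball a r \<union> - {a} = UNIV" using g(1) by auto
  finally have u: "u holomorphic_on UNIV" .
  have ua: "u a \<noteq> 0" using g(1,4) ug by simp
  have hu: "h z = (z - a) ^ m * u z" for z
    using g(1) g(3)[of a] by (cases "z = a") (auto simp: u_def)
  show thesis by (rule that[OF zero_mult_eqI[OF u ua hu] u ua hu])
qed

lemma zero_mult_zero [simp]: "zero_mult a (\<lambda>_. 0) = \<infinity>"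
  by (simp add: zero_mult_def)

lemma zero_mult_eq_infinity_iff [simp]: "zero_mult a h = \<infinity> \<longleftrightarrow> h = (\<lambda>_. 0)"
  by (simp add: zero_mult_def)

lemma zero_mult_mult:
  assumes "f holomorphic_on UNIV" "g holomorphic_on UNIV"
  shows "zero_mult a (\<lambda>z. f z * g z) = zero_mult a f + zero_mult a g"
proof (cases "f = (\<lambda>_. 0) \<or> g = (\<lambda>_. 0)")
  case True
  then show ?thesis by (auto simp: plus_eq_infty_iff_enat)
next
  case False
  obtain m u where u: "zero_mult a f = enat m" "u holomorphic_on UNIV" "u a \<noteq> 0"
    "\<And>z. f z = (z - a) ^ m * u z" using False by (auto intro: zero_mult_factor[OF assms(1), of a])
  obtain n v where v: "zero_mult a g = enat n" "v holomorphic_on UNIV" "v a \<noteq> 0"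
    "\<And>z. g z = (z - a) ^ n * v z" using False by (auto intro: zero_mult_factor[OF assms(2), of a])
  have "zero_mult a (\<lambda>z. f z * g z) = enat (m + n)"
    by (rule zero_mult_eqI[where u="\<lambda>z. u z * v z"])
       (use u v in \<open>auto intro!: holomorphic_intros simp: power_add\<close>)
  then show ?thesis using u v by simp
qed

lemma zero_mult_linear_power:
  "zero_mult a (\<lambda>z. (z - b) ^ m) = (if a = b then enat m else 0)"
proof (cases "a = b")
  case True
  then show ?thesis by (auto intro!: zero_mult_eqI[where u="\<lambda>_. 1"])
next
  case False
  then show ?thesis unfolding zero_enat_def
    by (auto intro!: zero_mult_eqI[where u="\<lambda>z. (z - b) ^ m"] holomorphic_intros)
qed

lemma zero_mult_eq_0:
  assumes "h holomorphic_on UNIV"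
  shows "zero_mult a h = 0 \<longleftrightarrow> h a \<noteq> 0"
proof
  assume "h a \<noteq> 0"
  then show "zero_mult a h = 0" unfolding zero_enat_def
    by (intro zero_mult_eqI[where u=h]) (use assms in auto)
next
  assume 0: "zero_mult a h = 0"
  then have "h \<noteq> (\<lambda>_. 0)" by auto
  from assms this obtain m u where u: "zero_mult a h = enat m" "u holomorphic_on UNIV" "u a \<noteq> 0"
    "\<And>z. h z = (z - a) ^ m * u z" by (rule zero_mult_factor[where a=a]) (rule that)
  with 0 have "m = 0" by (simp add: zero_enat_def)
  with u show "h a \<noteq> 0" by simp
qed

lemma enat_le_zero_mult_iff:
  assumes h: "h holomorphic_on UNIV"
  shows "enat k \<le> zero_mult a h \<longleftrightarrow> (\<exists>u. u holomorphic_on UNIV \<and> (\<forall>z. h z = (z - a) ^ k * u z))"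
proof
  assume le: "enat k \<le> zero_mult a h"
  show "\<exists>u. u holomorphic_on UNIV \<and> (\<forall>z. h z = (z - a) ^ k * u z)"
  proof (cases "h = (\<lambda>_. 0)")
    case True
    then show ?thesis by (intro exI[of _ "\<lambda>_. 0"]) auto
  next
    case False
    from h this obtain m u where u: "zero_mult a h = enat m" "u holomorphic_on UNIV" "u a \<noteq> 0"
      "\<And>z. h z = (z - a) ^ m * u z" by (rule zero_mult_factor[where a=a]) (rule that)
    with le have "k \<le> m" by simp
    then have "h z = (z - a) ^ k * ((z - a) ^ (m - k) * u z)" for z
      by (simp add: u(4) flip: mult.assoc power_add)
    then show ?thesis using u(2)
      by (intro exI[of _ "\<lambda>z. (z - a) ^ (m - k) * u z"]) (auto intro!: holomorphic_intros)
  qed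
next
  assume "\<exists>u. u holomorphic_on UNIV \<and> (\<forall>z. h z = (z - a) ^ k * u z)"
  then obtain u where u: "u holomorphic_on UNIV" "h = (\<lambda>z. (z - a) ^ k * u z)" by auto
  have "zero_mult a h = enat k + zero_mult a u"
    unfolding u(2) by (subst zero_mult_mult) (auto simp: zero_mult_linear_power u intro!: holomorphic_intros)
  then show "enat k \<le> zero_mult a h" by simp
qed

text \<open>The order of a zero is the index of the first nonvanishing derivative. This links
  \<open>variety_space\<close>, defined by derivatives, to multiplicities, which are additive under
  products.\<close>

lemma enat_le_zero_mult_iff_deriv:
  assumes h: "h holomorphic_on UNIV"
  shows "enat k \<le> zero_mult a h \<longleftrightarrow> (\<forall>j<k. (deriv ^^ j) h a = 0)"
proof (cases "h = (\<lambda>_. 0)")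
  case True
  have "(deriv ^^ j) (\<lambda>_::complex. 0::complex) = (\<lambda>_. 0)" for j by (induction j) auto
  with True show ?thesis by simp
next
  case False
  have "\<exists>n. (deriv ^^ n) h a \<noteq> 0"
  proof (rule ccontr)
    assume "\<not> ?thesis"
    then have "h w = 0" for w
      using holomorphic_fun_eq_0_on_connected[OF h open_UNIV connected_UNIV, of a w] by auto
    with False show False by auto
  qed
  then obtain n where n: "(deriv ^^ n) h a \<noteq> 0" "\<And>i. i < n \<Longrightarrow> (deriv ^^ i) h a = 0"
    using exists_least_iff[of "\<lambda>n. (deriv ^^ n) h a \<noteq> 0"] by blast
  have "zorder h a = int n"
    by (rule zorder_zero_eqI[OF h open_UNIV UNIV_I]) (use n in auto)
  then have "zero_mult a h = enat n" using False by (simp add: zero_mult_def)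
  then show ?thesis using n by (auto simp: not_less[symmetric] intro: less_le_trans)
qed

text \<open>Near each point a common power of z - a cancels and leaves a denominator that is nonzero
  at a. All singularities of the quotient are therefore removable.\<close>

lemma entire_dvdI:
  assumes p: "p holomorphic_on UNIV" "p \<noteq> (\<lambda>_. 0)" and f: "f holomorphic_on UNIV"
    and le: "\<And>a. zero_mult a p \<le> zero_mult a f"
  obtains u where "u holomorphic_on UNIV" "\<And>z. f z = p z * u z"
proof -
  define u where "u = remove_sings (\<lambda>z. f z / p z)"
  have "\<exists>r>0. u holomorphic_on ball a r \<and> f a = p a * u a" for a
  proof -
    obtain m P where P: "zero_mult a p = enat m" "P holomorphic_on UNIV" "P a \<noteq> 0"
      "\<And>z. p z = (z - a) ^ m * P z" by (rule zero_mult_factor[OF p, of a]) (rule that)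
    obtain F where F: "F holomorphic_on UNIV" "\<And>z. f z = (z - a) ^ m * F z"
      using le[of a] P(1) enat_le_zero_mult_iff[OF f] by metis
    have "isCont P a"
      using P(2) holomorphic_on_imp_continuous_on continuous_on_eq_continuous_at open_UNIV by blast
    from continuous_at_avoid[OF this P(3)] obtain r where r: "r > 0" "\<And>z. z \<in> ball a r \<Longrightarrow> P z \<noteq> 0"
      by (auto simp: dist_commute)
    have u: "u b = F b / P b" if b: "b \<in> ball a r" for b
      unfolding u_def
    proof (rule remove_sings_eqI)
      have "isCont (\<lambda>z. F z / P z) b"
        using F P(2) r(2)[OF b] holomorphic_on_imp_continuous_on[of _ UNIV]
        by (intro continuous_intros) (auto simp: continuous_on_eq_continuous_at)
      then have "(\<lambda>z. F z / P z) \<midarrow>b\<rightarrow> F b / P b" by (simp add: isCont_def)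
      moreover have "\<forall>\<^sub>F z in at b. z \<noteq> a"
        by (cases "a = b") (auto simp: eventually_neq_at_within eventually_at_filter)
      then have "\<forall>\<^sub>F z in at b. F z / P z = f z / p z"
        by eventually_elim (simp add: F P(4))
      ultimately show "(\<lambda>z. f z / p z) \<midarrow>b\<rightarrow> F b / P b" by (rule Lim_transform_eventually)
    qed
    have "(\<lambda>z. F z / P z) holomorphic_on ball a r"
      using F P(2) r(2) by (intro holomorphic_intros) (auto intro: holomorphic_on_subset)
    then have "u holomorphic_on ball a r" by (rule holomorphic_transform) (simp add: u)
    moreover have "f a = p a * u a" using u[of a] r(1) P(3) by (simp add: F P(4))
    ultimately show ?thesis using r(1) by blast
  qed
  then have "u field_differentiable at a" "f a = p a * u a" for a
    by (metis centre_in_ball holomorphic_on_imp_differentiable_at open_ball, metis)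
  then show thesis by (intro that[of u]) (auto simp: holomorphic_on_def field_differentiable_at_within)
qed

section \<open>Quotients by polynomials and the admissible denominators\<close>

lemma poly_fun_eq_0_iff: "poly p = (\<lambda>_. 0) \<longleftrightarrow> p = (0 :: complex poly)"
  using poly_eq_poly_eq_iff[of p 0] by (simp add: fun_eq_iff)

lemma quot_eqI:
  assumes "p \<noteq> 0" "e holomorphic_on UNIV" "\<And>z. g z = e z * poly p z"
  shows "quot g p = e"
  unfolding quot_def
proof (intro ext remove_sings_eqI)
  fix z
  have "isCont e z"
    using assms(2) holomorphic_on_imp_continuous_on continuous_on_eq_continuous_at open_UNIV by blast
  then have "e \<midarrow>z\<rightarrow> e z" by (simp add: isCont_def)
  moreover have "\<forall>\<^sub>F w in at z. poly p w \<noteq> 0"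
  proof -
    have "open (- ({w. poly p w = 0} - {z}))"
      using poly_roots_finite[OF assms(1)] by (intro open_Compl finite_imp_closed) auto
    then have "\<forall>\<^sub>F w in at z. w \<in> - ({w. poly p w = 0} - {z}) - {z}"
      by (rule eventually_at_in_open) simp
    then show ?thesis by eventually_elim auto
  qed
  then have "\<forall>\<^sub>F w in at z. e w = g w / poly p w"
    by eventually_elim (simp add: assms(3))
  ultimately show "(\<lambda>w. g w / poly p w) \<midarrow>z\<rightarrow> e z" by (rule Lim_transform_eventually)
qed

lemma entire_denominatorsD:
  assumes g: "g holomorphic_on UNIV" and p: "p \<in> entire_denominators g"
  shows "quot g p holomorphic_on UNIV" "poly p 0 = 1" "p \<noteq> 0" "g z = quot g p z * poly p z"
proof -
  show *: "quot g p holomorphic_on UNIV" "poly p 0 = 1" "p \<noteq> 0"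
    using p by (auto simp: entire_denominators_def entire_iff)
  have "g w = quot g p w * poly p w" if "poly p w \<noteq> 0" for w
  proof -
    have "(\<lambda>z. g z / poly p z) analytic_on {w}"
      using that g
      by (intro analytic_on_divide holomorphic_on_imp_analytic_at[OF _ open_UNIV] poly_holomorphic_on
          holomorphic_on_ident) auto
    then show ?thesis using that by (simp add: quot_def)
  qed
  \<comment> \<open>At the zeros of \<open>p\<close> both sides are 0, so the identity holds
    everywhere; cancelling the entire factor \<open>poly p\<close> then recovers the factorisation
    at those zeros too.\<close>
  then have "poly p w * g w = poly p w * (quot g p w * poly p w)" for w by auto
  then have "g = (\<lambda>z. quot g p z * poly p z)"
    by (intro entire_mult_cancel_left[of "poly p"])
       (use * g in \<open>auto intro!: holomorphic_intros simp: poly_fun_eq_0_iff\<close>)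
  then show "g z = quot g p z * poly p z" by metis
qed

lemma entire_denominatorsI:
  assumes "poly p 0 = 1" "e holomorphic_on UNIV" "\<And>z. g z = e z * poly p z"
  shows "p \<in> entire_denominators g" "quot g p = e"
proof -
  have "p \<noteq> 0" using assms(1) by auto
  from quot_eqI[OF this assms(2,3)] show "quot g p = e" .
  with assms show "p \<in> entire_denominators g" by (simp add: entire_denominators_def entire_iff)
qed

section \<open>Common zeros of a set of functions\<close>

lemma zero_mult_set_attained:
  assumes "h \<in> S"
  obtains f where "f \<in> S" "zero_mult a f = zero_mult_set a S"
proof -
  have "zero_mult_set a S \<in> zero_mult a ` S"
    unfolding zero_mult_set_def Inf_enat_def using assms by (auto intro: LeastI)
  then show thesis using that by auto
qed

lemma zero_mult_set_le: "f \<in> S \<Longrightarrow> zero_mult_set a S \<le> zero_mult a f"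
  unfolding zero_mult_set_def by (rule INF_lower)

text \<open>The nonzero \<open>h\<close> keeps every \<open>zero_mult_set a S\<close> finite; a
  point of infinite multiplicity would drop out of \<open>variety_of_set\<close>, whose entries are
  natural numbers. Points of multiplicity 0 impose no condition.\<close>

lemma variety_space_variety_of_set:
  assumes "f holomorphic_on UNIV" "h \<in> S" "h \<noteq> (\<lambda>_. 0)" "\<And>h. h \<in> S \<Longrightarrow> h holomorphic_on UNIV"
  shows "f \<in> variety_space (variety_of_set S) \<longleftrightarrow> (\<forall>a. zero_mult_set a S \<le> zero_mult a f)"
proof -
  have fin: "\<exists>n. zero_mult_set a S = enat n" for a
    using zero_mult_set_le[OF assms(2), of a] assms(3)
    by (metis enat_ord_simps(5) not_enat_eq zero_mult_eq_infinity_iff)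
  have z: "(\<forall>h\<in>S. h a = 0) \<longleftrightarrow> zero_mult_set a S \<noteq> 0" for a
  proof
    assume "\<forall>h\<in>S. h a = 0"
    then show "zero_mult_set a S \<noteq> 0"
      using zero_mult_set_attained[OF assms(2), of a] zero_mult_eq_0 assms(4) by metis
  next
    assume "zero_mult_set a S \<noteq> 0"
    then show "\<forall>h\<in>S. h a = 0"
      using zero_mult_set_le[of _ S a] zero_mult_eq_0[OF assms(4), of _ a] by (metis ile0_eq)
  qed
  have "f \<in> variety_space (variety_of_set S) \<longleftrightarrow>
      (\<forall>a n. zero_mult_set a S \<noteq> 0 \<and> enat n = zero_mult_set a S \<longrightarrow> enat n \<le> zero_mult a f)"
    using assms(1) unfolding variety_space_def variety_of_set_def z entire_iff
    by (auto simp: enat_le_zero_mult_iff_deriv[OF assms(1), symmetric])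
  also have "\<dots> \<longleftrightarrow> (\<forall>a. zero_mult_set a S \<le> zero_mult a f)"
    using fin by (metis zero_le)
  finally show ?thesis .
qed

subsection \<open>Annihilators of invariant subspaces\<close>

text \<open>The numerator f - f(0) g0 vanishes at 0 because g0(0) = 1, and the value prescribed at 0
  is its derivative there; so the singularity is removed.\<close>

lemma pommiez_holomorphic:
  assumes "g0 holomorphic_on UNIV" "f holomorphic_on UNIV" "g0 0 = 1"
  shows "pommiez g0 f holomorphic_on UNIV"
proof (rule pole_theorem_open_0[where g="\<lambda>z. f z - f 0 * g0 z" and a=0])
  show "(\<lambda>z. f z - f 0 * g0 z) holomorphic_on UNIV"
    using assms by (intro holomorphic_intros)
  have "f field_differentiable at 0" "g0 field_differentiable at 0"
    using assms holomorphic_on_imp_differentiable_at[OF _ open_UNIV UNIV_I] by blast+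
  then show "pommiez g0 f 0 = deriv (\<lambda>z. f z - f 0 * g0 z) 0"
    by (simp add: pommiez_def field_differentiable_mult)
qed (auto simp: pommiez_def assms)

lemma times_pommiez:
  assumes "g0 0 = 1"
  shows "z * pommiez g0 f z = f z - f 0 * g0 z"
  using assms by (auto simp: pommiez_def)

lemma eq_0_if_all_zero_mult:
  assumes "h holomorphic_on UNIV" "\<And>k. enat k \<le> zero_mult a h"
  shows "h = (\<lambda>_. 0)"
proof -
  have "zero_mult a h = \<infinity>" using assms(2) by (metis Suc_ile_eq enat.exhaust order_less_irrefl)
  then show ?thesis by simp
qed

text \<open>Dividing by z again and again without leaving \<open>A\<close> produces a zero of every
  order at 0.\<close>

lemma eq_0_if_times_closed:
  assumes A: "\<And>f. f \<in> A \<Longrightarrow> f holomorphic_on UNIV"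
    and div: "\<And>f. f \<in> A \<Longrightarrow> \<exists>f'\<in>A. \<forall>z. f z = z * f' z" and f: "f \<in> A"
  shows "f = (\<lambda>_. 0)"
proof (rule eq_0_if_all_zero_mult[OF A[OF f]])
  have "\<exists>u\<in>A. \<forall>z. f z = z ^ k * u z" for k
  proof (induction k)
    case (Suc k)
    then obtain u where u: "u \<in> A" "\<And>z. f z = z ^ k * u z" by blast
    obtain v where v: "v \<in> A" "\<And>z. u z = z * v z" using div[OF u(1)] by blast
    show ?case using u(2) v by (intro bexI[of _ v]) (auto simp: mult_ac)
  qed (use f in auto)
  then show "enat k \<le> zero_mult 0 f" for k
    using A enat_le_zero_mult_iff[OF A[OF f], of k 0] by (metis diff_zero)
qed

lemma outside_disc_open: "open {z::complex. R < norm z}"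
  by (intro open_Collect_less continuous_intros)

lemma entire_eq_outside_disc:
  assumes "f holomorphic_on UNIV" "g holomorphic_on UNIV" "\<And>z. R < norm z \<Longrightarrow> f z = g z"
  shows "f z = (g z :: complex)"
proof (rule analytic_continuation_open[of "{z. R < norm z}" UNIV f g z])
  show "open {z::complex. R < norm z}" by (rule outside_disc_open)
  show "{z::complex. R < norm z} \<noteq> {}"
    by (auto intro!: exI[of _ "of_real (\<bar>R\<bar> + 1)"] simp del: of_real_add)
qed (use assms in auto)

locale pommiez_invariant =
  fixes g0 :: "complex \<Rightarrow> complex" and S :: "(complex \<Rightarrow> complex) set"
  assumes g0: "g0 holomorphic_on UNIV" "g0 0 = 1" and S: "proper_closed_invariant g0 S"
begin

lemma subspace: "entire_subspace S" and closed: "closedin entire_topology S"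
  and invariant: "f \<in> S \<Longrightarrow> pommiez g0 f \<in> S"
  using S by (auto simp: proper_closed_invariant_def)

lemma holo: "f \<in> S \<Longrightarrow> f holomorphic_on UNIV"
  using subspace by (auto simp: entire_subspace_def entire_functions_def)

lemma g0_nonzero: "g0 \<noteq> (\<lambda>_. 0)" using g0(2) by auto

lemma nonzero_element: obtains h where "h \<in> S" "h \<noteq> (\<lambda>_. 0)"
  using S by (auto simp: proper_closed_invariant_def entire_subspace_def)

text \<open>At a common zero a, evaluating z D f = f - f(0) g0 gives f(0) g0(a) = 0, hence f(0) = 0
  for all f in \<open>S\<close>. Then D f = f / z stays in \<open>S\<close>, and \<open>S\<close>
  collapses to 0.\<close>

lemma no_common_zero:
  assumes "g0 a \<noteq> 0"
  shows "\<exists>f\<in>S. f a \<noteq> 0"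
proof (rule ccontr)
  assume "\<not> ?thesis"
  then have fa: "f a = 0" if "f \<in> S" for f using that by blast
  have f0: "f 0 = 0" if "f \<in> S" for f
  proof -
    have "a * pommiez g0 f a = f a - f 0 * g0 a" by (rule times_pommiez[of g0 a f, OF g0(2)])
    then show ?thesis using fa[OF that] fa[OF invariant[OF that]] assms by simp
  qed
  have "f = (\<lambda>_. 0)" if "f \<in> S" for f
  proof (rule eq_0_if_times_closed[of S])
    show "\<exists>f'\<in>S. \<forall>z. f z = z * f' z" if "f \<in> S" for f
      using invariant[OF that] times_pommiez[of g0 _ f, OF g0(2)] f0[OF that] by (intro bexI[of _ "pommiez g0 f"]) auto
  qed (use holo that in auto)
  then show False using nonzero_element by blast
qed

text \<open>When the functional attached to \<open>\<psi>\<close> annihilates \<open>S\<close>, the entire parts satisfy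
  \<open>z \<omega>(D f) = \<omega>(f) - f(0) \<omega>(g0)\<close>, so that \<open>E(f) = g0 \<omega>(f) - f \<omega>(g0)\<close> satisfies
  \<open>z E(D f) = E(f)\<close> and vanishes to infinite order at 0.\<close>

lemma annihilator_identity:
  assumes om: "\<And>f. f \<in> S \<Longrightarrow> laurent_split \<psi> f (om f) 0" and w0: "laurent_split \<psi> g0 \<omega>0 l0"
    and f: "f \<in> S"
  shows "g0 z * om f z = f z * \<omega>0 z"
proof -
  define E where "E f z = g0 z * om f z - f z * \<omega>0 z" for f z
  have omh: "om f holomorphic_on UNIV" if "f \<in> S" for f using om[OF that] by (simp add: laurent_split_def)
  have w0h: "\<omega>0 holomorphic_on UNIV" using w0 by (simp add: laurent_split_def)
  have step: "z * om (pommiez g0 f) z = om f z - f 0 * \<omega>0 z" if f: "f \<in> S" for f z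
  proof -
    let ?F = "pommiez g0 f"
    \<comment> \<open>Subtracting \<open>c\<close> makes division by z possible. The quotient
      \<open>u\<close> is then an entire part for D f with 1/z coefficient \<open>c\<close>; as D f
      lies in \<open>S\<close>, this coefficient is 0.\<close>
    define c where "c = om f 0 - f 0 * \<omega>0 0"
    have "(\<lambda>z. om f z - f 0 * \<omega>0 z - c) holomorphic_on UNIV"
      using omh[OF f] w0h by (intro holomorphic_intros)
    moreover have "om f 0 - f 0 * \<omega>0 0 - c = 0" by (simp add: c_def)
    ultimately obtain u where u: "u holomorphic_on UNIV" "\<And>z. om f z - f 0 * \<omega>0 z - c = (z - 0) * u z"
      by (rule entire_divide_linear) (rule that)
    have eq: "z * (?F z * \<psi> z - u z) = (f z * \<psi> z - om f z) - f 0 * (g0 z * \<psi> z - \<omega>0 z) + c" for z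
      using times_pommiez[of g0 z f, OF g0(2)] u(2)[of z] by algebra
    have "((\<lambda>z. z * (?F z * \<psi> z - u z)) \<longlongrightarrow> 0 - f 0 * 0 + c) at_infinity"
      unfolding eq by (intro tendsto_intros laurent_split_tendsto_0[OF om[OF f]] laurent_split_tendsto_0[OF w0])
    then have "laurent_split \<psi> ?F u c" using u(1) by (simp add: laurent_split_def)
    moreover note om[OF invariant[OF f]]
    ultimately have "c = 0" "u = om ?F"
      using laurent_split_unique_value laurent_split_unique[of \<psi> ?F "om ?F" 0 u]
        laurent_split_tendsto_0 u(1) by metis+
    then show ?thesis using u(2)[of z] by simp
  qed
  have "E f = (\<lambda>_. 0)"
  proof (rule eq_0_if_times_closed[of "E ` S"])
    fix h assume "h \<in> E ` S"
    then obtain f where f: "f \<in> S" "h = E f" by blast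
    show "h holomorphic_on UNIV"
      unfolding f(2) E_def using g0 omh[OF f(1)] holo[OF f(1)] w0h by (intro holomorphic_intros)
    have "E f z = z * E (pommiez g0 f) z" for z
      using step[OF f(1), of z] times_pommiez[of g0 z f, OF g0(2)] unfolding E_def by algebra
    then show "\<exists>h'\<in>E ` S. \<forall>z. h z = z * h' z" using invariant f by blast
  qed (use f in simp)
  then show ?thesis by (simp add: E_def fun_eq_iff)
qed

end

text \<open>Near infinity \<psi> = om f / f for every nonzero f in \<open>S\<close>, so om h / h
  does not depend on the choice of h. Its pole order at a is bounded by the multiplicity of each
  such f, hence by the smallest one, which \<open>F\<close> compensates. So F \<psi> agrees near
  infinity with an entire function and its remainder is 0 there.\<close>

lemma ideal_annihilator:
  assumes holo: "\<And>f. f \<in> S \<Longrightarrow> f holomorphic_on UNIV" and \<psi>: "\<psi> holomorphic_on {z. R < norm z}"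
    and om: "\<And>f. f \<in> S \<Longrightarrow> om f holomorphic_on UNIV"
      "\<And>f z. f \<in> S \<Longrightarrow> R < norm z \<Longrightarrow> f z * \<psi> z = om f z"
    and h: "h \<in> S" "h \<noteq> (\<lambda>_. 0)"
    and F: "F holomorphic_on UNIV" "\<And>a. zero_mult_set a S \<le> zero_mult a F"
  shows "\<exists>U. laurent_split \<psi> F U 0"
proof -
  have id: "f z * om h z = h z * om f z" if "f \<in> S" for f z
    by (rule entire_eq_outside_disc[where R=R])
       (use holo om h that in \<open>auto intro!: holomorphic_intros simp flip: om(2)\<close>)
  have "zero_mult a h \<le> zero_mult a (\<lambda>z. F z * om h z)" for a
  proof -
    obtain f where f: "f \<in> S" "zero_mult a f = zero_mult_set a S"
      using zero_mult_set_attained[OF h(1)] by blast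
    have "zero_mult a h \<le> zero_mult a h + zero_mult a (om f)" by simp
    also have "\<dots> = zero_mult a f + zero_mult a (om h)"
      unfolding zero_mult_mult[OF holo[OF h(1)] om(1)[OF f(1)], symmetric]
        zero_mult_mult[OF holo[OF f(1)] om(1)[OF h(1)], symmetric] id[OF f(1)] ..
    also have "\<dots> \<le> zero_mult a F + zero_mult a (om h)" using F(2)[of a] f(2) by (intro add_right_mono) simp
    also have "\<dots> = zero_mult a (\<lambda>z. F z * om h z)" using F om h by (simp add: zero_mult_mult)
    finally show ?thesis .
  qed
  moreover have "(\<lambda>z. F z * om h z) holomorphic_on UNIV" using F om h by (intro holomorphic_intros)
  ultimately obtain U where U: "U holomorphic_on UNIV" "\<And>z. F z * om h z = h z * U z"
    using entire_dvdI[OF holo[OF h(1)] h(2), of "\<lambda>z. F z * om h z"] by metis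
  have "F z * \<psi> z - U z = 0" if z: "R < norm z" for z
  proof (rule entire_mult_cancel[OF holo[OF h(1)] h(2) outside_disc_open[of R],
      where X="\<lambda>z. F z * \<psi> z - U z"])
    have "(\<lambda>z. F z * \<psi> z - U z) holomorphic_on {z. R < norm z}"
      using F U \<psi> by (intro holomorphic_intros) (auto intro: holomorphic_on_subset)
    then show "continuous_on {z. R < norm z} (\<lambda>z. F z * \<psi> z - U z)"
      by (rule holomorphic_on_imp_continuous_on)
    show "h z * (F z * \<psi> z - U z) = 0" if "z \<in> {z. R < norm z}" for z
      proof -
      have "h z * \<psi> z = om h z" using om(2)[OF h(1)] that by simp
      then have "h z * (F z * \<psi> z) = F z * om h z" by (metis mult.left_commute)
      then show ?thesis using U(2)[of z] by (simp add: right_diff_distrib)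
    qed
  qed (use z in simp)
  then have "\<forall>\<^sub>F z in at_infinity. 0 = z * (F z * \<psi> z - U z)"
    unfolding eventually_at_infinity by (intro exI[of _ "R + 1"]) auto
  then have "((\<lambda>z. z * (F z * \<psi> z - U z)) \<longlongrightarrow> 0) at_infinity"
    by (rule Lim_transform_eventually[OF tendsto_const])
  then show ?thesis using U(1) by (auto simp: laurent_split_def)
qed

section \<open>Orders and growth at infinity\<close>

text \<open>In the coordinate w = 1/z the function extends by 0 to w = 0. Being nonconstant, it is
  w^m times a function that stays away from 0 near w = 0.\<close>

lemma order_at_infinity:
  assumes G: "G holomorphic_on {z. R < norm z}" "(G \<longlongrightarrow> 0) at_infinity" and R: "R > 0"
    and nz: "R < norm z0" "G z0 \<noteq> 0"
  obtains c m \<rho> where "c > 0" "\<rho> > R" "\<And>z. norm z \<ge> \<rho> \<Longrightarrow> c \<le> norm (G z) * norm z ^ m"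
proof -
  define H where "H w = (if w = 0 then 0 else G (inverse w))" for w
  have Hb: "H holomorphic_on ball 0 (1 / R)"
  proof (rule no_isolated_singularity'[of "{0}"])
    have "((G \<circ> inverse) \<longlongrightarrow> 0) (at 0)" using G(2) by (simp add: lim_at_infinity_0)
    then have "(H \<longlongrightarrow> 0) (at 0)"
      by (rule Lim_transform_eventually) (auto simp: H_def eventually_at_filter)
    then show "(H \<longlongrightarrow> H z) (at z within ball 0 (1 / R))" if "z \<in> {0}" for z
      using that by (auto simp: H_def intro: Lim_at_imp_Lim_at_within)
    have "R < norm (inverse x)" if "norm x < 1 / R" "x \<noteq> 0" for x :: complex
      using less_imp_inverse_less[OF that(1)] that R by (simp add: norm_inverse)
    then have "(G \<circ> inverse) holomorphic_on ball 0 (1 / R) - {0}"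
      using G(1) R by (intro holomorphic_on_compose_gen[where t="{z. R < norm z}"] holomorphic_intros)
        auto
    then show "H holomorphic_on ball 0 (1 / R) - {0}"
      by (rule holomorphic_transform) (auto simp: H_def)
  qed auto
  have z0: "z0 \<noteq> 0" using nz R by auto
  have i0: "inverse z0 \<in> ball 0 (1 / R)"
    using nz R frac_less2[of 1 1 R "norm z0"] by (simp add: norm_divide inverse_eq_divide)
  have c0: "(0::complex) \<in> ball 0 (1 / R)" using R by simp
  have H0: "H 0 = 0" by (simp add: H_def)
  have "H (inverse z0) \<noteq> H 0" using nz(2) z0 by (simp add: H_def)
  then have "\<not> H constant_on ball 0 (1 / R)"
    using i0 c0 unfolding constant_on_def by metis
  with Hb open_ball connected_ball c0 H0 obtain g r m where
    g: "0 < m" "0 < r" "ball (0::complex) r \<subseteq> ball 0 (1 / R)" "g holomorphic_on ball 0 r"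
      "\<And>w. w \<in> ball 0 r \<Longrightarrow> H w = (w - 0) ^ m * g w" "\<And>w. w \<in> ball 0 r \<Longrightarrow> g w \<noteq> 0"
    by (rule holomorphic_factor_zero_nonconstant) (rule that)
  have "isCont g 0"
    using holomorphic_on_imp_continuous_on[OF g(4)] g(2) by (simp add: continuous_on_eq_continuous_at)
  moreover have "norm (g 0) / 2 > 0" using g(2,6) by auto
  ultimately obtain d where d: "d > 0" "\<And>w. norm w < d \<Longrightarrow> norm (g w - g 0) < norm (g 0) / 2"
    unfolding continuous_at_eps_delta by (metis dist_norm diff_zero)
  \<comment> \<open>Beyond this radius 1/z lies in the disc of the factorisation and in the disc
    where \<open>g\<close> stays within half of |g 0|; the 2 makes both inequalities strict.\<close>
  define \<rho> where "\<rho> = max (R + 1) (max (2 / r) (2 / d))"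
  show thesis
  proof (rule that[of "norm (g 0) / 2" \<rho> m])
    show "\<rho> > R" by (simp add: \<rho>_def)
    fix z :: complex assume z: "norm z \<ge> \<rho>"
    have zp: "norm z > 0" using z R by (simp only: \<rho>_def)
    have "norm z \<ge> 2 / r" "norm z \<ge> 2 / d" using z by (auto simp: \<rho>_def)
    then have *: "norm (inverse z) < r" "norm (inverse z) < d"
      unfolding norm_inverse using zp g(2) d(1) by (auto simp: field_simps simp del: zero_less_norm_iff)
    have "norm (g 0) - norm (g (inverse z)) \<le> norm (g 0 - g (inverse z))"
      by (rule norm_triangle_ineq2)
    with d(2)[OF *(2)] have "norm (g (inverse z)) \<ge> norm (g 0) / 2" by (simp add: norm_minus_commute)
    moreover have "G z = inverse z ^ m * g (inverse z)"
      using g(5)[of "inverse z"] * zp by (auto simp: H_def)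
    then have "norm (G z) * norm z ^ m = norm (g (inverse z))"
      using zp by (simp add: norm_mult norm_power norm_inverse power_inverse)
    ultimately show "norm (g 0) / 2 \<le> norm (G z) * norm z ^ m" by simp
  qed (use \<open>norm (g 0) / 2 > 0\<close> in auto)
qed

text \<open>This moves the zeros in \<open>Z\<close>, with full multiplicity, into a polynomial. It
  is applied to the zeros of g0 in a disc outside of which f / g0 has no poles for any f in the
  invariant space.\<close>

lemma finite_zeros_factor:
  assumes g: "g holomorphic_on UNIV" "g \<noteq> (\<lambda>_. 0)" and Z: "finite Z"
  obtains P k where "P \<noteq> 0" "k holomorphic_on UNIV" "\<And>z. g z = poly P z * k z" "\<And>z. z \<in> Z \<Longrightarrow> k z \<noteq> 0"
  using Z
proof (induction Z arbitrary: thesis rule: finite_induct)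
  case empty
  show ?case by (rule empty[of 1 g]) (use g in auto)
next
  case (insert a Z)
  obtain P k where P: "P \<noteq> 0" "k holomorphic_on UNIV" "\<And>z. g z = poly P z * k z" "\<And>z. z \<in> Z \<Longrightarrow> k z \<noteq> 0"
    by (rule insert.IH) (rule that)
  have "k \<noteq> (\<lambda>_. 0)" using g(2) P(3) by auto
  with P(2) obtain m u where u: "zero_mult a k = enat m" "u holomorphic_on UNIV" "u a \<noteq> 0"
    "\<And>z. k z = (z - a) ^ m * u z" by (rule zero_mult_factor[where a=a]) (rule that)
  show ?case
  proof (rule insert.prems[of "P * [:-a, 1:] ^ m" u])
    show "g z = poly (P * [:- a, 1:] ^ m) z * u z" for z using P(3) u(4) by simp
    show "u z \<noteq> 0" if "z \<in> insert a Z" for z using that u(3,4) P(4) by auto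
  qed (use P(1) u in auto)
qed

lemma poly_growth:
  fixes P :: "complex poly"
  shows "\<exists>A C. \<forall>z. A \<le> norm z \<longrightarrow> norm (poly P z) \<le> C * norm z ^ degree P"
proof -
  have "\<forall>\<^sub>F z in at_infinity. norm (poly P z / z ^ degree P) < norm (lead_coeff P) + 1"
    by (rule order_tendstoD(2)[OF tendsto_norm[OF poly_divide_tendsto_aux]]) simp
  then obtain b where b: "\<And>z. b \<le> norm z \<Longrightarrow> norm (poly P z / z ^ degree P) < norm (lead_coeff P) + 1"
    unfolding eventually_at_infinity by blast
  show ?thesis
  proof (intro exI allI impI)
    fix z :: complex assume z: "max b 1 \<le> norm z"
    then have "norm z ^ degree P > 0" by (auto intro!: zero_less_power)
    then show "norm (poly P z) \<le> (norm (lead_coeff P) + 1) * norm z ^ degree P"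
      using b[of z] z by (simp add: norm_divide norm_power pos_divide_less_eq less_imp_le)
  qed
qed

lemma entire_polynomial_growth:
  assumes q: "q holomorphic_on UNIV" "\<And>z. A \<le> norm z \<Longrightarrow> norm (q z) \<le> C * norm z ^ n"
  obtains Q where "degree Q \<le> n" "q = poly Q"
proof (rule that[of "\<Sum>k\<le>n. monom ((deriv ^^ k) q 0 / fact k) k"])
  show "degree (\<Sum>k\<le>n. monom ((deriv ^^ k) q 0 / fact k) k) \<le> n"
    by (rule degree_sum_le) (auto intro: order_trans[OF degree_monom_le])
  show "q = poly (\<Sum>k\<le>n. monom ((deriv ^^ k) q 0 / fact k) k)"
    by (rule ext) (subst Liouville_polynomial[OF q], simp_all add: poly_sum poly_monom)
qed

subsection \<open>A common denominator\<close>

context pommiez_invariant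
begin

lemma subset_variety_space: "S \<subseteq> variety_space (variety_of_set S)"
proof
  fix f assume f: "f \<in> S"
  obtain h where h: "h \<in> S" "h \<noteq> (\<lambda>_. 0)" by (rule nonzero_element)
  show "f \<in> variety_space (variety_of_set S)"
    using variety_space_variety_of_set[OF holo[OF f] h holo] zero_mult_set_le[OF f] by blast
qed

lemma common_denominator:
  assumes ne: "S \<noteq> variety_space (variety_of_set S)"
  shows "\<exists>P M. P \<in> entire_denominators g0 \<and>
           (\<forall>f\<in>S. \<exists>q. degree q \<le> M \<and> f = (\<lambda>z. quot g0 P z * poly q z))"
proof -
  obtain h where h: "h \<in> S" "h \<noteq> (\<lambda>_. 0)" by (rule nonzero_element)
  obtain F where F: "F \<in> variety_space (variety_of_set S)" "F \<notin> S"
    using ne subset_variety_space by blast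
  then have FE: "F \<in> entire_functions" by (simp add: variety_space_def)
  then have Fh: "F holomorphic_on UNIV" by (simp add: entire_iff)
  have Fm: "zero_mult_set a S \<le> zero_mult a F" for a
    using F(1) variety_space_variety_of_set[OF Fh h holo] by blast
  obtain \<psi> R where R: "R > 0" and \<psi>: "\<psi> holomorphic_on {z. R < norm z}"
    and ex: "\<And>f. f \<in> entire_functions \<Longrightarrow> \<exists>\<omega> l. laurent_split \<psi> f \<omega> l"
    and exS: "\<And>f. f \<in> S \<Longrightarrow> \<exists>\<omega>. laurent_split \<psi> f \<omega> 0"
    and nF: "\<And>\<omega>. \<not> laurent_split \<psi> F \<omega> 0"
    by (rule closed_subspace_separation[OF subspace closed FE F(2)]) (rule that)
  obtain om where om: "\<And>f. f \<in> S \<Longrightarrow> laurent_split \<psi> f (om f) 0" using exS by metis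
  obtain \<omega>0 l0 where w0: "laurent_split \<psi> g0 \<omega>0 l0" using ex[of g0] g0 by (auto simp: entire_iff)
  have id: "g0 z * om f z = f z * \<omega>0 z" if "f \<in> S" for f z
    by (rule annihilator_identity[OF _ w0 that]) (rule om)
  have omh: "om f holomorphic_on UNIV" if "f \<in> S" for f using om[OF that] by (simp add: laurent_split_def)
  have w0h: "\<omega>0 holomorphic_on UNIV" using w0 by (simp add: laurent_split_def)
  define G where "G f z = f z * \<psi> z - om f z" for f z
  define G0 where "G0 z = g0 z * \<psi> z - \<omega>0 z" for z
  have GG: "g0 z * G f z = f z * G0 z" if "f \<in> S" for f z
    using id[OF that, of z] by (simp add: G_def G0_def algebra_simps)
  have G0h: "G0 holomorphic_on {z. R < norm z}"
    unfolding G0_def using g0 w0h \<psi> by (intro holomorphic_intros) (auto intro: holomorphic_on_subset)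
  have Gh: "G f holomorphic_on {z. R < norm z}" if "f \<in> S" for f
    unfolding G_def using holo[OF that] omh[OF that] \<psi>
    by (intro holomorphic_intros) (auto intro: holomorphic_on_subset)
  have "\<exists>z0. R < norm z0 \<and> G0 z0 \<noteq> 0"
  proof (rule ccontr)
    assume 0: "\<not> ?thesis"
    have "f z * \<psi> z = om f z" if f: "f \<in> S" and z: "R < norm z" for f z
    proof -
      have "G f z = 0"
        by (rule entire_mult_cancel[OF g0(1) g0_nonzero outside_disc_open[of R]
              holomorphic_on_imp_continuous_on[OF Gh[OF f]]])
           (use 0 GG[OF f] z in auto)
      then show ?thesis by (simp add: G_def)
    qed
    then have "\<exists>U. laurent_split \<psi> F U 0"
      by (intro ideal_annihilator[OF holo \<psi> omh _ h Fh Fm]) auto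
    with nF show False by blast
  qed
  then obtain z0 where z0: "R < norm z0" "G0 z0 \<noteq> 0" by blast
  have "(G0 \<longlongrightarrow> 0) at_infinity"
    using laurent_split_tendsto_0[OF w0] by (simp add: G0_def[abs_def])
  from order_at_infinity[OF G0h this R z0]
  obtain c m \<rho> where c: "c > 0" "\<rho> > R" "\<And>z. norm z \<ge> \<rho> \<Longrightarrow> c \<le> norm (G0 z) * norm z ^ m"
    by metis
  have G0nz: "G0 z \<noteq> 0" if "norm z \<ge> \<rho>" for z using c(1) c(3)[OF that] by auto
  \<comment> \<open>For |z| >= \<rho> the quotient f / g0 = G f / G0 has no poles, so only the
    finitely many zeros of g0 in a disc have to enter the denominator. The extra 1 leaves room for
    gluing on a ring.\<close>
  have "finite {z \<in> cball 0 (\<rho> + 1). g0 z = 0}"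
  proof (cases "g0 constant_on UNIV")
    case True
    then have "g0 z \<noteq> 0" for z using g0(2) by (metis UNIV_I constant_on_def one_neq_zero)
    then show ?thesis by simp
  qed (use holomorphic_compact_finite_zeros[OF g0(1) open_UNIV connected_UNIV compact_cball] in blast)
  from finite_zeros_factor[OF g0(1) g0_nonzero this] obtain P k where
    P: "P \<noteq> 0" "k holomorphic_on UNIV" "\<And>z. g0 z = poly P z * k z"
       "\<And>z. norm z \<le> \<rho> + 1 \<Longrightarrow> g0 z = 0 \<Longrightarrow> k z \<noteq> 0"
    by (metis (mono_tags, lifting) dist_0_norm mem_Collect_eq mem_cball)
  have knz: "k z \<noteq> 0" if "norm z \<le> \<rho> + 1" for z using P(3)[of z] P(4)[OF that] by auto
  \<comment> \<open>The value at 0 is normalised to 1, using P(0) k(0) = g0(0) = 1.\<close>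
  define P1 where "P1 = smult (k 0) P"
  have P0: "poly P 0 * k 0 = 1" using P(3)[of 0] g0(2) by simp
  have k0: "k 0 \<noteq> 0" using P0 by auto
  have P10: "poly P1 0 = 1" using P0 by (simp add: P1_def mult.commute)
  have kh: "(\<lambda>z. k z / k 0) holomorphic_on UNIV" using P(2) k0 by (intro holomorphic_intros)
  have "g0 z = k z / k 0 * poly P1 z" for z using P(3) k0 by (simp add: P1_def)
  note P1 = entire_denominatorsI[OF P10 kh this]
  obtain A0 C where AC: "\<And>z. A0 \<le> norm z \<Longrightarrow> norm (poly P z) \<le> C * norm z ^ degree P"
    using poly_growth by blast
  \<comment> \<open>Near infinity |G f| < 1 and 1 / |G0| <= |z|^m / c, so f / k grows at most like
    |P(z)| |z|^m. The radius where this starts depends on f, the exponent does not.\<close>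
  define M where "M = degree P + m"
  have "\<exists>q. degree q \<le> M \<and> f = (\<lambda>z. quot g0 P1 z * poly q z)" if f: "f \<in> S" for f
  proof -
    \<comment> \<open>Two expressions for f / k that agree on the ring \<rho> < |z| < \<rho> + 1:
      \<open>k\<close> has no zeros on the disc, \<open>G0\<close> none outside the inner
      circle.\<close>
    define q where "q z = (if norm z < \<rho> + 1 then f z / k z else poly P z * G f z / G0 z)" for z
    have qk: "f z = k z * q z" for z
    proof (cases "norm z < \<rho> + 1")
      case False
      then have nz: "G0 z \<noteq> 0" using G0nz by simp
      have "f z * G0 z = k z * (poly P z * G f z)" using GG[OF f, of z] P(3)[of z] by (simp add: mult_ac)
      then show ?thesis using nz False by (simp add: q_def field_simps)
    qed (use knz[of z] in \<open>auto simp: q_def\<close>)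
    have q2: "q z = poly P z * G f z / G0 z" if z: "norm z > \<rho>" for z
    proof (cases "norm z < \<rho> + 1")
      case True
      then have nz: "G0 z \<noteq> 0" "k z \<noteq> 0" using G0nz knz z by auto
      have "f z * G0 z = k z * (poly P z * G f z)" using GG[OF f, of z] P(3)[of z] by (simp add: mult_ac)
      then show ?thesis using nz True by (simp add: q_def field_simps)
    qed (simp add: q_def)
    have "q holomorphic_on ball 0 (\<rho> + 1) \<union> {z. \<rho> < norm z}"
    proof (rule holomorphic_on_Un)
      have "(\<lambda>z. f z / k z) holomorphic_on ball 0 (\<rho> + 1)"
        using holo[OF f] P(2) knz by (intro holomorphic_intros) (auto intro: holomorphic_on_subset)
      then show "q holomorphic_on ball 0 (\<rho> + 1)"
        by (rule holomorphic_transform) (simp add: q_def)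
      have "(\<lambda>z. poly P z * G f z / G0 z) holomorphic_on {z. \<rho> < norm z}"
        using Gh[OF f] G0h G0nz c(2)
        by (intro holomorphic_intros) (auto intro: holomorphic_on_subset)
      then show "q holomorphic_on {z. \<rho> < norm z}"
        by (rule holomorphic_transform) (simp add: q2)
    qed (auto simp: outside_disc_open)
    also have "ball 0 (\<rho> + 1) \<union> {z. \<rho> < norm z} = UNIV" by auto
    finally have qh: "q holomorphic_on UNIV" .
    have "(G f \<longlongrightarrow> 0) at_infinity"
      using laurent_split_tendsto_0[OF om[OF f]] by (simp add: G_def[abs_def])
    then have "\<forall>\<^sub>F z in at_infinity. norm (G f z) < 1"
      using order_tendstoD(2)[OF tendsto_norm, of "G f" 0 at_infinity 1] by simp
    then obtain b where b: "\<And>z. b \<le> norm z \<Longrightarrow> norm (G f z) < 1"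
      unfolding eventually_at_infinity by blast
    have "norm (q z) \<le> (C / c) * norm z ^ M" if z: "max (max b A0) (\<rho> + 1) \<le> norm z" for z
    proof -
      have nz: "norm (G0 z) > 0" using G0nz[of z] z by simp
      have cz: "c \<le> norm (G0 z) * norm z ^ m" by (rule c(3)) (use z in auto)
      have Pz: "norm (poly P z) \<le> C * norm z ^ degree P" by (rule AC) (use z in auto)
      then have C0: "0 \<le> C * norm z ^ degree P" by (rule order_trans[OF norm_ge_zero])
      have "norm (q z) = norm (poly P z) * norm (G f z) / norm (G0 z)"
        using q2[of z] z by (simp add: norm_mult norm_divide)
      also have "\<dots> \<le> (C * norm z ^ degree P) * 1 / norm (G0 z)"
        using Pz b[of z] z C0 by (intro divide_right_mono mult_mono) auto
      also have "\<dots> \<le> (C * norm z ^ degree P) * (norm z ^ m / c)"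
      proof -
        have "1 / norm (G0 z) \<le> norm z ^ m / c" using cz nz c(1) by (simp add: field_simps)
        from mult_left_mono[OF this C0] show ?thesis by simp
      qed
      also have "\<dots> = (C / c) * norm z ^ M" by (simp add: M_def power_add)
      finally show ?thesis .
    qed
    then obtain Q where Q: "degree Q \<le> M" "q = poly Q"
      using entire_polynomial_growth[OF qh, of "max (max b A0) (\<rho> + 1)" "C / c" M] by metis
    have "f z = quot g0 P1 z * poly (smult (k 0) Q) z" for z
      using qk[of z] k0 by (simp add: P1 Q(2))
    then show ?thesis using Q(1) by (intro exI[of _ "smult (k 0) Q"]) auto
  qed
  with P1(1) show ?thesis by blast
qed

text \<open>A common zero a of the numerators is impossible for \<open>P\<close> of least degree. If
  P(a) = 0, the factor z - a cancels and the degree of \<open>P\<close> drops. If not, the argument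
  of \<open>no_common_zero\<close> applies to the numerators.\<close>

lemma reduced_denominator:
  assumes ne: "S \<noteq> variety_space (variety_of_set S)"
  obtains P M where "P \<in> entire_denominators g0"
    "\<And>f. f \<in> S \<Longrightarrow> \<exists>q. degree q \<le> M \<and> f = (\<lambda>z. quot g0 P z * poly q z)"
    "\<And>a. \<exists>q. (\<lambda>z. quot g0 P z * poly q z) \<in> S \<and> poly q a \<noteq> 0"
proof -
  define good where "good P \<longleftrightarrow> P \<in> entire_denominators g0 \<and>
           (\<exists>M. \<forall>f\<in>S. \<exists>q. degree q \<le> M \<and> f = (\<lambda>z. quot g0 P z * poly q z))" for P
  have "\<exists>P. good P" using common_denominator[OF ne] by (auto simp: good_def)
  then obtain P where P: "good P" "\<And>P'. good P' \<Longrightarrow> degree P \<le> degree P'"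
    using ex_has_least_nat[of good _ degree] by blast
  obtain M where PD: "P \<in> entire_denominators g0"
    and M: "\<And>f. f \<in> S \<Longrightarrow> \<exists>q. degree q \<le> M \<and> f = (\<lambda>z. quot g0 P z * poly q z)"
    using P(1) unfolding good_def by blast
  define e where "e = quot g0 P"
  have e: "e holomorphic_on UNIV" "poly P 0 = 1" "P \<noteq> 0" "\<And>z. g0 z = e z * poly P z"
    using entire_denominatorsD[OF g0(1) PD] unfolding e_def by blast+
  have ene: "e \<noteq> (\<lambda>_. 0)" using e(4)[of 0] g0(2) by auto
  show thesis
  proof (rule that[OF PD M])
    fix a
    show "\<exists>q. (\<lambda>z. quot g0 P z * poly q z) \<in> S \<and> poly q a \<noteq> 0"
    proof (rule ccontr)
      assume "\<not> ?thesis"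
      then have qa: "poly q a = 0" if "(\<lambda>z. e z * poly q z) \<in> S" for q
        using that unfolding e_def by blast
      show False
      proof (cases "poly P a = 0")
        case False
        have f0: "f 0 = 0" if f: "f \<in> S" for f
        proof -
          obtain q where q: "f = (\<lambda>z. e z * poly q z)" using M[OF f] by (auto simp: e_def)
          obtain q' where q': "pommiez g0 f = (\<lambda>z. e z * poly q' z)"
            using M[OF invariant[OF f]] by (auto simp: e_def)
          \<comment> \<open>On numerators the operator acts as q |-> (q - q(0) P) / z; evaluation at
            a leaves q(0) P(a) = 0.\<close>
          have "e z * (z * poly q' z) = e z * (poly q z - poly q 0 * poly P z)" for z
          proof -
            have "z * pommiez g0 f z = f z - f 0 * g0 z" by (rule times_pommiez[of g0, OF g0(2)])
            moreover have "e 0 = 1" using e(2) e(4)[of 0] g0(2) by simp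
            moreover have "pommiez g0 f z = e z * poly q' z" "f z = e z * poly q z" "f 0 = e 0 * poly q 0"
              by (simp add: q', simp_all add: q)
            ultimately show ?thesis using e(4)[of z] by (simp add: algebra_simps)
          qed
          then have "(\<lambda>z. z * poly q' z) = (\<lambda>z. poly q z - poly q 0 * poly P z)"
            by (intro entire_mult_cancel_left[OF e(1) ene] holomorphic_intros)
          from fun_cong[OF this, of a] have "a * poly q' a = poly q a - poly q 0 * poly P a" .
          moreover have "poly q a = 0" "poly q' a = 0"
            using qa[of q] qa[of q'] f invariant[OF f] q q' by auto
          ultimately have "poly q 0 = 0" using False by simp
          then show ?thesis by (simp add: q)
        qed
        then show False using no_common_zero[of 0] g0(2) by auto
      next
        case True
        then have a0: "a \<noteq> 0" using e(2) by auto
        from True obtain P1 where P1: "P = [:-a, 1:] * P1" by (auto simp: poly_eq_0_iff_dvd)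
        \<comment> \<open>The factor -a restores the value 1 at 0 after the removal of z - a; it is
          nonzero because P(0) = 1.\<close>
        define P' where "P' = smult (- a) P1"
        have P'0: "poly P' 0 = 1" using e(2) by (simp add: P1 P'_def)
        have deg: "degree P' < degree P" 
        proof -
          have "P1 \<noteq> 0" using e(3) P1 by auto
          then have "degree P = 1 + degree P1" unfolding P1 by (subst degree_mult_eq) auto
          then show ?thesis using a0 by (simp add: P'_def)
        qed
        have e': "(\<lambda>z. e z * (z - a) / (- a)) holomorphic_on UNIV"
          using e(1) a0 by (intro holomorphic_intros) auto
        have "g0 z = e z * (z - a) / (- a) * poly P' z" for z
          using a0 unfolding e(4) P'_def P1 by (simp add: divide_simps) (simp add: algebra_simps)
        from entire_denominatorsI[OF P'0 e' this]
        have P'D: "P' \<in> entire_denominators g0" and quot': "quot g0 P' = (\<lambda>z. e z * (z - a) / (- a))"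
          by auto
        have "\<exists>q. degree q \<le> M \<and> f = (\<lambda>z. quot g0 P' z * poly q z)" if f: "f \<in> S" for f
        proof -
          obtain q where q: "degree q \<le> M" "f = (\<lambda>z. e z * poly q z)" using M[OF f] by (auto simp: e_def)
          then have "poly q a = 0" using qa[of q] f by auto
          then obtain q1 where q1: "q = [:-a, 1:] * q1" by (auto simp: poly_eq_0_iff_dvd)
          have "degree (smult (- a) q1) \<le> M"
          proof (cases "q1 = 0")
            case False
            then have "degree q = 1 + degree q1" unfolding q1 by (subst degree_mult_eq) auto
            with q(1) show ?thesis by (simp add: a0)
          qed simp
          moreover have "f = (\<lambda>z. quot g0 P' z * poly (smult (- a) q1) z)"
            using a0 by (auto simp: q(2) q1 quot' field_simps)
          ultimately show ?thesis by blast
        qed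
        then have "good P'" using P'D by (auto simp: good_def)
        with P(2)[of P'] deg show False by simp
      qed
    qed
  qed
qed

end

subsection \<open>The dichotomy\<close>

lemma zero_mult_poly:
  assumes "p \<noteq> 0"
  shows "zero_mult a (poly p) = enat (order a p)"
proof -
  obtain q where q: "p = [:- a, 1:] ^ order a p * q" "\<not> [:- a, 1:] dvd q"
    using order_decomp[OF assms] by blast
  show ?thesis
  proof (rule zero_mult_eqI[of "poly q"])
    show "poly q a \<noteq> 0" using q(2) by (simp add: poly_eq_0_iff_dvd)
    show "poly p z = (z - a) ^ order a p * poly q z" for z
      by (subst q(1)) (simp add: poly_power)
  qed (intro holomorphic_intros)
qed

lemma zero_mult_eq_if_variety_of_fun_eq:
  assumes e: "e holomorphic_on UNIV" "e \<noteq> (\<lambda>_. 0)" and e': "e' holomorphic_on UNIV" "e' \<noteq> (\<lambda>_. 0)"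
    and eq: "variety_of_fun e = variety_of_fun e'"
  shows "zero_mult a e = zero_mult a e'"
proof -
  obtain n n' where n: "zero_mult a e = enat n" "zero_mult a e' = enat n'"
    using e(2) e'(2) by (meson not_infinity_eq zero_mult_eq_infinity_iff)
  have *: "(a, n) \<in> variety_of_fun e \<longleftrightarrow> e a = 0" "(a, n') \<in> variety_of_fun e' \<longleftrightarrow> e' a = 0"
    using n by (simp_all add: variety_of_fun_def)
  show ?thesis
  proof (cases "e a = 0")
    case True
    then have "(a, n) \<in> variety_of_fun e'" using * eq by simp
    then show ?thesis using n by (simp add: variety_of_fun_def)
  next
    case False
    have "e' a \<noteq> 0"
    proof
      assume "e' a = 0"
      then have "(a, n') \<in> variety_of_fun e" using * eq by simp
      with False show False by (simp add: variety_of_fun_def)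
    qed
    then show ?thesis using zero_mult_eq_0[OF e(1)] zero_mult_eq_0[OF e'(1)] False by metis
  qed
qed

text \<open>Equal zeros of the quotients force equal root orders of the two polynomials, and the
  value 1 at 0 fixes the leading coefficient. This makes the description in \<open>pS\<close>
  definite.\<close>

lemma entire_denominators_unique:
  assumes g: "g holomorphic_on UNIV" "g 0 = 1"
    and p: "p \<in> entire_denominators g" and p': "p' \<in> entire_denominators g"
    and eq: "variety_of_fun (quot g p) = variety_of_fun (quot g p')"
  shows "p = p'"
proof -
  note d = entire_denominatorsD[OF g(1) p] and d' = entire_denominatorsD[OF g(1) p']
  have nz: "quot g p \<noteq> (\<lambda>_. 0)" "quot g p' \<noteq> (\<lambda>_. 0)"
    using d(4)[of 0] d'(4)[of 0] g(2) by auto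
  have ord: "order a p = order a p'" for a
  proof -
    have "zero_mult a (\<lambda>z. quot g p z * poly p z) = zero_mult a (\<lambda>z. quot g p' z * poly p' z)"
      by (rule arg_cong[where f="zero_mult a"]) (simp add: fun_eq_iff flip: d(4) d'(4))
    then have "zero_mult a (quot g p) + enat (order a p) = zero_mult a (quot g p') + enat (order a p')"
      using d(1,3) d'(1,3) by (simp add: zero_mult_mult holomorphic_intros zero_mult_poly)
    then show ?thesis
      using zero_mult_eq_if_variety_of_fun_eq[OF d(1) nz(1) d'(1) nz(2) eq, of a] nz(2)
      by (cases "zero_mult a (quot g p')") auto
  qed
  have roots: "poly p z = 0 \<longleftrightarrow> poly p' z = 0" for z
    using ord[of z] d(3) d'(3) by (simp add: order_root)
  define r where "r = (\<Prod>z|poly p z = 0. [:-z, 1:] ^ order z p)"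
  have 1: "smult (lead_coeff p) r = p" unfolding r_def by (rule complex_poly_decompose)
  have 2: "smult (lead_coeff p') r = p'"
    using complex_poly_decompose[of p'] by (simp add: r_def roots ord)
  have "lead_coeff p * poly r 0 = 1" "lead_coeff p' * poly r 0 = 1"
    using d(2) d'(2) arg_cong[OF 1, of "\<lambda>q. poly q 0"] arg_cong[OF 2, of "\<lambda>q. poly q 0"] by simp_all
  then have "lead_coeff p * poly r 0 = lead_coeff p' * poly r 0" "poly r 0 \<noteq> 0" by auto
  then have "lead_coeff p = lead_coeff p'" by simp
  then have "smult (lead_coeff p) r = smult (lead_coeff p') r" by simp
  then show ?thesis unfolding 1 2 .
qed

lemma fmult_polys_upto_iff:
  "f \<in> fmult h (polys_upto n) \<longleftrightarrow> (\<exists>q. degree q \<le> n \<and> f = (\<lambda>z. h z * poly q z))"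
  by (auto simp: fmult_def polys_upto_def)

lemma entire_subspace_sum:
  assumes S: "entire_subspace S" and "finite I" "\<And>i. i \<in> I \<Longrightarrow> f i \<in> S"
  shows "(\<lambda>z. \<Sum>i\<in>I. f i z) \<in> S"
  using assms(2,3)
proof (induction I rule: finite_induct)
  case empty
  then show ?case using S by (simp add: entire_subspace_def)
next
  case (insert i I)
  then show ?case using S by (simp add: entire_subspace_def)
qed

lemma fmult_polys_upto_subset:
  assumes S: "entire_subspace S" and e: "\<And>j. j \<le> n \<Longrightarrow> (\<lambda>z. e z * z ^ j) \<in> S"
  shows "fmult e (polys_upto n) \<subseteq> S"
proof
  fix f assume "f \<in> fmult e (polys_upto n)"
  then obtain q where q: "degree q \<le> n" "f = (\<lambda>z. e z * poly q z)"
    by (auto simp: fmult_polys_upto_iff)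
  have "(\<lambda>z. \<Sum>j\<le>degree q. coeff q j * (e z * z ^ j)) \<in> S"
    by (rule entire_subspace_sum[OF S]) (use S e q(1) in \<open>auto simp: entire_subspace_def\<close>)
  also have "(\<lambda>z. \<Sum>j\<le>degree q. coeff q j * (e z * z ^ j)) = f"
    by (simp add: q(2) poly_altdef sum_distrib_left mult_ac)
  finally show "f \<in> S" .
qed

context pommiez_invariant
begin

text \<open>A functional annihilating \<open>S\<close> gives \<open>P \<omega>(e q) = q \<omega>(g0)\<close>, where \<open>e = g0 / P\<close>; as the \<open>q\<close>
  have no common zero, \<open>P\<close> divides \<open>\<omega>(g0)\<close>. By uniqueness of the entire part the quotient is \<open>\<omega>(e)\<close>,
  so that \<open>G(e q1) = q1 G(e)\<close>. Hence \<open>z^(deg q1 + 1) G(e)\<close> tends to 0 at infinity.\<close>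

lemma power_multiple_mem:
  assumes P: "P \<in> entire_denominators g0"
    and repr: "\<And>f. f \<in> S \<Longrightarrow> \<exists>q. f = (\<lambda>z. quot g0 P z * poly q z)"
    and ncz: "\<And>a. \<exists>q. (\<lambda>z. quot g0 P z * poly q z) \<in> S \<and> poly q a \<noteq> 0"
    and q1: "(\<lambda>z. quot g0 P z * poly q1 z) \<in> S" "q1 \<noteq> 0" and j: "j \<le> degree q1"
  shows "(\<lambda>z. quot g0 P z * z ^ j) \<in> S"
proof (rule ccontr)
  define e where "e = quot g0 P"
  have e: "e holomorphic_on UNIV" "poly P 0 = 1" "P \<noteq> 0" "\<And>z. g0 z = e z * poly P z"
    using entire_denominatorsD[OF g0(1) P] unfolding e_def by blast+
  have ene: "e \<noteq> (\<lambda>_. 0)" using e(4)[of 0] g0(2) by auto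
  have Pne: "poly P \<noteq> (\<lambda>_. 0)" using e(3) by (simp add: poly_fun_eq_0_iff)
  have Ph: "poly P holomorphic_on UNIV" by (intro holomorphic_intros)
  assume "(\<lambda>z. quot g0 P z * z ^ j) \<notin> S"
  then have notS: "(\<lambda>z. e z * z ^ j) \<notin> S" by (simp add: e_def)
  have eE: "(\<lambda>z. e z * z ^ j) \<in> entire_functions"
    unfolding entire_iff using e(1) by (intro holomorphic_intros)
  obtain \<psi> R where R: "R > 0" and \<psi>: "\<psi> holomorphic_on {z. R < norm z}"
    and ex: "\<And>f. f \<in> entire_functions \<Longrightarrow> \<exists>\<omega> l. laurent_split \<psi> f \<omega> l"
    and exS: "\<And>f. f \<in> S \<Longrightarrow> \<exists>\<omega>. laurent_split \<psi> f \<omega> 0"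
    and nF: "\<And>\<omega>. \<not> laurent_split \<psi> (\<lambda>z. e z * z ^ j) \<omega> 0"
    by (rule closed_subspace_separation[OF subspace closed eE notS]) (rule that)
  obtain om where om: "\<And>f. f \<in> S \<Longrightarrow> laurent_split \<psi> f (om f) 0" using exS by metis
  obtain \<omega>0 l0 where w0: "laurent_split \<psi> g0 \<omega>0 l0" using ex[of g0] g0 by (auto simp: entire_iff)
  obtain \<omega>e le where we: "laurent_split \<psi> e \<omega>e le" using ex[of e] e by (auto simp: entire_iff)
  have id: "g0 z * om f z = f z * \<omega>0 z" if "f \<in> S" for f z
    by (rule annihilator_identity[OF _ w0 that]) (rule om)
  have omh: "om f holomorphic_on UNIV" if "f \<in> S" for f using om[OF that] by (simp add: laurent_split_def)
  have w0h: "\<omega>0 holomorphic_on UNIV" using w0 by (simp add: laurent_split_def)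
  have key: "poly P z * om (\<lambda>z. e z * poly q z) z = poly q z * \<omega>0 z"
    if q: "(\<lambda>z. e z * poly q z) \<in> S" for q z
  proof -
    have "(\<lambda>z. poly P z * om (\<lambda>z. e z * poly q z) z) = (\<lambda>z. poly q z * \<omega>0 z)"
      by (rule entire_mult_cancel_left[OF e(1) ene])
         (use id[OF q] omh[OF q] w0h in \<open>auto intro!: holomorphic_intros simp: e(4) mult_ac\<close>)
    then show ?thesis by metis
  qed
  have "zero_mult a (poly P) \<le> zero_mult a \<omega>0" for a
  proof -
    obtain q where q: "(\<lambda>z. e z * poly q z) \<in> S" "poly q a \<noteq> 0" using ncz[of a] by (auto simp: e_def)
    let ?o = "om (\<lambda>z. e z * poly q z)"
    have "zero_mult a (poly P) \<le> zero_mult a (poly P) + zero_mult a ?o" by simp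
    also have "\<dots> = zero_mult a (\<lambda>z. poly P z * ?o z)"
      by (rule zero_mult_mult[OF Ph omh[OF q(1)], symmetric])
    also have "\<dots> = zero_mult a (\<lambda>z. poly q z * \<omega>0 z)" by (simp only: key[OF q(1)])
    also have "\<dots> = zero_mult a (poly q) + zero_mult a \<omega>0"
      using w0h by (intro zero_mult_mult holomorphic_intros)
    also have "zero_mult a (poly q) = 0"
      using q(2) by (subst zero_mult_eq_0) (auto intro!: holomorphic_intros)
    finally show ?thesis by simp
  qed
  from entire_dvdI[OF Ph Pne w0h this] obtain h where
    h: "h holomorphic_on UNIV" "\<And>z. \<omega>0 z = poly P z * h z" by metis
  have oq: "om (\<lambda>z. e z * poly q z) = (\<lambda>z. poly q z * h z)" if q: "(\<lambda>z. e z * poly q z) \<in> S" for q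
    by (rule entire_mult_cancel_left[OF Ph Pne])
       (use key[OF q] omh[OF q] h in \<open>auto intro!: holomorphic_intros simp: mult_ac\<close>)
  have lim_inv: "((\<lambda>z. z ^ degree p / poly p z) \<longlongrightarrow> inverse (lead_coeff p)) at_infinity"
    if "p \<noteq> 0" for p :: "complex poly"
    using tendsto_inverse[OF poly_divide_tendsto_aux[of p]] that by (simp add: inverse_eq_divide)
  \<comment> \<open>The remainder of g0 is P times e \<psi> - h. Writing 1 / P as z^-deg P times a
    factor with a finite limit shows that dividing by \<open>P\<close> keeps the limit 0.\<close>
  have "((\<lambda>z. (g0 z * \<psi> z - \<omega>0 z) * inverse z ^ degree P * (z ^ degree P / poly P z))
      \<longlongrightarrow> 0 * 0 ^ degree P * inverse (lead_coeff P)) at_infinity"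
    by (intro tendsto_intros laurent_split_tendsto_0[OF w0] tendsto_inverse_0 lim_inv e(3))
  moreover have "\<forall>\<^sub>F z in at_infinity. (g0 z * \<psi> z - \<omega>0 z) * inverse z ^ degree P * (z ^ degree P / poly P z)
      = e z * \<psi> z - h z"
  proof -
    have "\<forall>\<^sub>F z in at_infinity. poly P z \<noteq> 0"
    proof -
      have "\<forall>\<^sub>F z in at_infinity. poly P z / z ^ degree P \<noteq> 0"
        by (rule tendsto_imp_eventually_ne[OF poly_divide_tendsto_aux]) (use e(3) in simp)
      then show ?thesis by eventually_elim auto
    qed
    then show ?thesis using eventually_not_equal_at_infinity[of 0]
    proof eventually_elim
      case (elim z)
      have "g0 z * \<psi> z - \<omega>0 z = (e z * \<psi> z - h z) * poly P z"
        by (simp add: e(4) h(2) algebra_simps)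
      with elim show ?case by (simp add: power_inverse)
    qed
  qed
  ultimately have "((\<lambda>z. e z * \<psi> z - h z) \<longlongrightarrow> 0) at_infinity"
    by (simp add: filterlim_cong)
  from laurent_split_unique[OF we h(1) this] have he: "h = \<omega>e" .
  define n where "n = degree q1"
  have q1S: "(\<lambda>z. e z * poly q1 z) \<in> S" using q1(1) by (simp add: e_def)
  define Ge where "Ge z = e z * \<psi> z - h z" for z
  have "((\<lambda>z. z * (poly q1 z * Ge z)) \<longlongrightarrow> 0) at_infinity"
    using om[OF q1S] by (simp add: laurent_split_def oq[OF q1S] Ge_def algebra_simps)
  \<comment> \<open>The quotient z^n / q1 has a finite limit, so it trades q1 for z^n; the power
    z^-(n-j) then lowers the exponent to j.\<close>
  then have "((\<lambda>z. z * (poly q1 z * Ge z) * (z ^ n / poly q1 z) * inverse z ^ (n - j))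
      \<longlongrightarrow> 0 * inverse (lead_coeff q1) * 0 ^ (n - j)) at_infinity"
    unfolding n_def by (intro tendsto_mult tendsto_power tendsto_inverse_0 lim_inv q1(2))
  moreover have "\<forall>\<^sub>F z in at_infinity. z * (poly q1 z * Ge z) * (z ^ n / poly q1 z) * inverse z ^ (n - j)
      = z * (e z * z ^ j * \<psi> z - z ^ j * h z)"
  proof -
    have "\<forall>\<^sub>F z in at_infinity. poly q1 z \<noteq> 0"
    proof -
      have "\<forall>\<^sub>F z in at_infinity. poly q1 z / z ^ degree q1 \<noteq> 0"
        by (rule tendsto_imp_eventually_ne[OF poly_divide_tendsto_aux]) (use q1(2) in simp)
      then show ?thesis by eventually_elim auto
    qed
    then show ?thesis using eventually_not_equal_at_infinity[of 0]
    proof eventually_elim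
      case (elim z)
      have "z ^ n = z ^ j * z ^ (n - j)" using j by (simp add: n_def flip: power_add)
      with elim have "z ^ n * inverse z ^ (n - j) = z ^ j" by (simp add: power_inverse)
      moreover have "z * (poly q1 z * Ge z) * (z ^ n / poly q1 z) * inverse z ^ (n - j)
          = z * Ge z * (z ^ n * inverse z ^ (n - j))" using elim by simp
      ultimately show ?case by (simp add: Ge_def algebra_simps)
    qed
  qed
  ultimately have "((\<lambda>z. z * (e z * z ^ j * \<psi> z - z ^ j * h z)) \<longlongrightarrow> 0) at_infinity"
    by (simp add: filterlim_cong)
  then have "laurent_split \<psi> (\<lambda>z. e z * z ^ j) (\<lambda>z. z ^ j * h z) 0"
    unfolding laurent_split_def using h(1) by (auto intro!: holomorphic_intros)
  with nF show False by blast
qed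

text \<open>A numerator of maximal degree n brings every e z^j with j <= n into \<open>S\<close>, by
  \<open>power_multiple_mem\<close>; their span is all of e C[z]_n. Since the numerators have no
  common zero, the common zeros of \<open>S\<close> are those of e, which identifies
  \<open>P\<close> as p_S.\<close>

lemma polynomial_multiples:
  assumes ne: "S \<noteq> variety_space (variety_of_set S)"
  obtains P n where "P \<in> entire_denominators g0" "variety_of_set S = variety_of_fun (quot g0 P)"
    "S = fmult (quot g0 P) (polys_upto n)"
proof -
  obtain P M where P: "P \<in> entire_denominators g0"
    and M: "\<And>f. f \<in> S \<Longrightarrow> \<exists>q. degree q \<le> M \<and> f = (\<lambda>z. quot g0 P z * poly q z)"
    and ncz: "\<And>a. \<exists>q. (\<lambda>z. quot g0 P z * poly q z) \<in> S \<and> poly q a \<noteq> 0"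
    by (rule reduced_denominator[OF ne]) (rule that)
  define e where "e = quot g0 P"
  have e: "e holomorphic_on UNIV" "\<And>z. g0 z = e z * poly P z"
    using entire_denominatorsD[OF g0(1) P] unfolding e_def by blast+
  have ene: "e \<noteq> (\<lambda>_. 0)" using e(2)[of 0] g0(2) by auto
  have unique: "q = q'" if "(\<lambda>z. e z * poly q z) = (\<lambda>z. e z * poly q' z)" for q q'
  proof -
    have "poly q = poly q'"
      by (rule entire_mult_cancel_left[OF e(1) ene]) (use fun_cong[OF that] in \<open>auto intro!: holomorphic_intros\<close>)
    then show ?thesis by (simp add: poly_eq_poly_eq_iff)
  qed
  define Q where "Q = {q. (\<lambda>z. e z * poly q z) \<in> S \<and> q \<noteq> 0}"
  have QM: "degree q \<le> M" if "q \<in> Q" for q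
  proof -
    have "(\<lambda>z. e z * poly q z) \<in> S" using that by (simp add: Q_def)
    from M[OF this] obtain q' where q': "degree q' \<le> M"
      "(\<lambda>z. e z * poly q z) = (\<lambda>z. e z * poly q' z)" by (auto simp: e_def)
    with unique show ?thesis by metis
  qed
  obtain q0 where "(\<lambda>z. e z * poly q0 z) \<in> S" "poly q0 0 \<noteq> 0" using ncz[of 0] by (auto simp: e_def)
  then have "q0 \<in> Q" by (auto simp: Q_def)
  have "finite (degree ` Q)" by (rule finite_subset[of _ "{..M}"]) (use QM in auto)
  define n where "n = Max (degree ` Q)"
  have "n \<in> degree ` Q" unfolding n_def by (rule Max_in) (use \<open>finite (degree ` Q)\<close> \<open>q0 \<in> Q\<close> in auto)
  then obtain q1 where q1: "q1 \<in> Q" "degree q1 = n" by auto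
  have nmax: "degree q \<le> n" if "q \<in> Q" for q
    unfolding n_def by (rule Max_ge) (use \<open>finite (degree ` Q)\<close> that in auto)
  have 1: "S \<subseteq> fmult e (polys_upto n)"
  proof
    fix f assume f: "f \<in> S"
    obtain q where q: "f = (\<lambda>z. e z * poly q z)" using M[OF f] by (auto simp: e_def)
    have "degree q \<le> n"
      using nmax[of q] f q by (cases "q = 0") (auto simp: Q_def)
    with q show "f \<in> fmult e (polys_upto n)" by (auto simp: fmult_polys_upto_iff)
  qed
  have 2: "fmult e (polys_upto n) \<subseteq> S"
  proof (rule fmult_polys_upto_subset[OF subspace])
    fix j assume "j \<le> n"
    then have j: "j \<le> degree q1" using q1(2) by simp
    have q1S: "(\<lambda>z. quot g0 P z * poly q1 z) \<in> S" "q1 \<noteq> 0" using q1(1) by (auto simp: Q_def e_def)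
    show "(\<lambda>z. e z * z ^ j) \<in> S"
      unfolding e_def by (rule power_multiple_mem[OF P _ ncz q1S j]) (use M in blast)
  qed
  have zm: "zero_mult_set a S = zero_mult a e" for a
  proof (rule antisym)
    obtain q where q: "(\<lambda>z. e z * poly q z) \<in> S" "poly q a \<noteq> 0" using ncz[of a] by (auto simp: e_def)
    have "zero_mult a (poly q) = 0"
      using q(2) by (subst zero_mult_eq_0) (auto intro!: holomorphic_intros)
    then have "zero_mult a (\<lambda>z. e z * poly q z) = zero_mult a e"
      using zero_mult_mult[OF e(1), of "poly q" a] by (simp add: holomorphic_intros)
    with zero_mult_set_le[OF q(1), of a] show "zero_mult_set a S \<le> zero_mult a e" by simp
    have "zero_mult a e \<le> zero_mult a f" if f: "f \<in> S" for f
    proof -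
      obtain q where q: "f = (\<lambda>z. e z * poly q z)" using M[OF f] by (auto simp: e_def)
      show ?thesis using zero_mult_mult[OF e(1), of "poly q" a] by (simp add: holomorphic_intros q)
    qed
    then show "zero_mult a e \<le> zero_mult_set a S"
      unfolding zero_mult_set_def by (auto intro: INF_greatest)
  qed
  have z0: "(\<forall>h\<in>S. h a = 0) \<longleftrightarrow> e a = 0" for a
    using ncz[of a] M by (fastforce simp: e_def)
  have "variety_of_set S = variety_of_fun e"
    unfolding variety_of_set_def variety_of_fun_def by (simp add: zm z0)
  with 1 2 P show thesis by (intro that[of P n]) (auto simp: e_def)
qed

lemma pS_eq:
  assumes "P \<in> entire_denominators g0" "variety_of_set S = variety_of_fun (quot g0 P)"
  shows "pS g0 S = P"
  unfolding pS_def
  by (rule the_equality) (use assms entire_denominators_unique[OF g0] in auto)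

lemma nS_eq:
  assumes P: "P \<in> entire_denominators g0" "variety_of_set S = variety_of_fun (quot g0 P)"
    and eq: "S = fmult (quot g0 P) (polys_upto n)"
  shows "nS g0 S = n"
proof -
  define e where "e = quot g0 P"
  have e: "e holomorphic_on UNIV" "\<And>z. g0 z = e z * poly P z"
    using entire_denominatorsD[OF g0(1) P(1)] unfolding e_def by blast+
  have ene: "e \<noteq> (\<lambda>_. 0)" using e(2)[of 0] g0(2) by auto
  have rS: "rS g0 S (\<lambda>z. e z * poly q z) = q" for q
    unfolding rS_def pS_eq[OF P] e_def[symmetric]
  proof (rule the_equality)
    fix r assume r: "(\<lambda>z. e z * poly q z) = (\<lambda>z. e z * poly r z)"
    have "poly r = poly q"
      by (rule entire_mult_cancel_left[OF e(1) ene])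
         (use fun_cong[OF r, symmetric] in \<open>intro holomorphic_intros | assumption\<close>)+
    then show "r = q" by (simp add: poly_eq_poly_eq_iff)
  qed simp
  \<comment> \<open>Each d <= n is the degree of the numerator of e z^d, so the supremum is over a
    finite set with maximum n; the zero function contributes only the degree 0.\<close>
  have "(\<lambda>f. degree (rS g0 S f)) ` S = {..n}"
  proof (intro equalityI subsetI)
    fix d assume "d \<in> (\<lambda>f. degree (rS g0 S f)) ` S"
    then obtain f where f: "f \<in> S" "d = degree (rS g0 S f)" by blast
    then obtain q where "degree q \<le> n" "f = (\<lambda>z. e z * poly q z)"
      using eq by (metis e_def fmult_polys_upto_iff)
    with f rS show "d \<in> {..n}" by simp
  next
    fix d assume "d \<in> {..n}"
    then have "(\<lambda>z. e z * poly (monom 1 d) z) \<in> S"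
      using eq by (metis atMost_iff degree_monom_eq e_def fmult_polys_upto_iff zero_neq_one)
    moreover have "d = degree (rS g0 S (\<lambda>z. e z * poly (monom 1 d) z))"
      unfolding rS by (simp add: degree_monom_eq)
    ultimately show "d \<in> (\<lambda>f. degree (rS g0 S f)) ` S" by blast
  qed
  then show ?thesis by (simp add: nS_def cSup_eq_maximum)
qed

lemma subset_rational_multiples:
  assumes P: "P \<in> entire_denominators g0" and eq: "S = fmult (quot g0 P) (polys_upto n)"
  shows "S \<subseteq> rational_multiples g0"
proof
  fix f assume f: "f \<in> S"
  then obtain q where q: "f = (\<lambda>z. quot g0 P z * poly q z)" using eq by (metis fmult_polys_upto_iff)
  note d = entire_denominatorsD[OF g0(1) P]
  have "f z = g0 z * (poly q z / poly P z)" if "poly P z \<noteq> 0" for z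
    using that by (simp add: q d(4))
  then show "f \<in> rational_multiples g0"
    using holo[OF f] d(3) by (auto simp: rational_multiples_def entire_iff)
qed

lemma dichotomy:
  "S = variety_space (variety_of_set S) \<or>
     S \<subseteq> rational_multiples g0 \<and> S = fmult (quot g0 (pS g0 S)) (polys_upto (nS g0 S))"
proof (cases "S = variety_space (variety_of_set S)")
  case False
  then obtain P n where P: "P \<in> entire_denominators g0" "variety_of_set S = variety_of_fun (quot g0 P)"
    "S = fmult (quot g0 P) (polys_upto n)" by (rule polynomial_multiples) (rule that)
  show ?thesis
    using subset_rational_multiples[OF P(1,3)] P(3) pS_eq[OF P(1,2)] nS_eq[OF P] by simp
qed simp

text \<open>Without zeros of g0 the space \<open>S\<close> has no common zeros, so S(W(S)) is all of
  H(C), which properness excludes. A denominator divides g0, hence has no roots and is the constant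
  1.\<close>

lemma zero_free_case:
  assumes nz: "\<And>z. g0 z \<noteq> 0"
  shows "S \<subseteq> fmult g0 polys \<and> S = fmult g0 (polys_upto (nS g0 S))"
proof -
  have "variety_of_set S = {}"
    using no_common_zero nz by (auto simp: variety_of_set_def)
  then have "variety_space (variety_of_set S) = entire_functions" by (simp add: variety_space_def)
  then have "S \<noteq> variety_space (variety_of_set S)" using S by (simp add: proper_closed_invariant_def)
  then obtain P n where P: "P \<in> entire_denominators g0" "variety_of_set S = variety_of_fun (quot g0 P)"
    "S = fmult (quot g0 P) (polys_upto n)" by (rule polynomial_multiples) (rule that)
  note d = entire_denominatorsD[OF g0(1) P(1)]
  have "poly P z \<noteq> 0" for z using d(4)[of z] nz[of z] by auto
  then have "degree P = 0"
    using fundamental_theorem_of_algebra[of P] constant_degree[of P] by blast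
  then have "P = 1" using d(2) by (metis degree_eq_zeroE mult_zero_left poly_pCons add.right_neutral one_pCons)
  moreover have "quot g0 1 = g0" by (rule quot_eqI) (use g0 in auto)
  ultimately have eq: "S = fmult g0 (polys_upto n)" using P(3) by simp
  moreover have "fmult g0 (polys_upto n) \<subseteq> fmult g0 polys"
    by (auto simp: fmult_def polys_upto_def polys_def)
  ultimately show ?thesis using nS_eq[OF P] by simp
qed

end

subsection \<open>Invariance and closedness of the standard subspaces\<close>

text \<open>A Lipschitz bound by the supremum over one compact set keeps \<open>L\<close> nonzero on
  a basic neighbourhood of any f with L f nonzero.\<close>

lemma closedin_zero_functional:
  fixes L :: "(complex \<Rightarrow> complex) \<Rightarrow> complex"
  assumes K: "compact K" and L: "\<And>f g e. f \<in> entire_functions \<Longrightarrow> g \<in> entire_functions \<Longrightarrow> e > 0 \<Longrightarrow>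
      (\<And>z. z \<in> K \<Longrightarrow> norm (f z - g z) \<le> e) \<Longrightarrow> norm (L f - L g) \<le> C * e"
  shows "closedin entire_topology {f \<in> entire_functions. L f = 0}"
proof -
  have "openin entire_topology (entire_functions - {f \<in> entire_functions. L f = 0})"
    unfolding openin_entire_topology
  proof (intro conjI ballI)
    fix f assume "f \<in> entire_functions - {f \<in> entire_functions. L f = 0}"
    then have f: "f \<in> entire_functions" "L f \<noteq> 0" by auto
    \<comment> \<open>Dividing by |C| + 1 avoids a zero denominator and gives C e < |L f|
      strictly.\<close>
    define e where "e = norm (L f) / (\<bar>C\<bar> + 1)"
    have e: "e > 0" using f(2) by (simp add: e_def add_nonneg_pos)
    have "\<bar>C\<bar> * e < (\<bar>C\<bar> + 1) * e" using e by simp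
    also have "\<dots> = norm (L f)" by (simp add: e_def add_nonneg_pos)
    finally have Ce: "C * e < norm (L f)"
      using e mult_right_mono[of C "\<bar>C\<bar>" e] by linarith
    have "compact_nbhd K e f \<subseteq> entire_functions - {f \<in> entire_functions. L f = 0}"
    proof
      fix g assume "g \<in> compact_nbhd K e f"
      then have g: "g \<in> entire_functions" "\<And>z. z \<in> K \<Longrightarrow> norm (f z - g z) < e"
        by (auto simp: compact_nbhd_def dist_norm)
      have "norm (L f - L g) \<le> C * e" by (rule L[OF f(1) g(1) e]) (use g(2) in \<open>auto intro: less_imp_le\<close>)
      with Ce have "L g \<noteq> 0" by auto
      with g(1) show "g \<in> entire_functions - {f \<in> entire_functions. L f = 0}" by simp
    qed
    with K e show "\<exists>K e. compact K \<and> e > 0 \<and>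
        compact_nbhd K e f \<subseteq> entire_functions - {f \<in> entire_functions. L f = 0}" by blast
  qed auto
  then show ?thesis by (auto simp: closedin_def)
qed

text \<open>Cauchy's inequality on the closed unit disc around \<open>a\<close> gives the Lipschitz
  constant j!.\<close>

lemma closedin_deriv_zero:
  "closedin entire_topology {f \<in> entire_functions. (deriv ^^ j) f a = 0}"
proof (rule closedin_zero_functional[where K="cball a 1" and C="fact j"])
  fix f g :: "complex \<Rightarrow> complex" and e :: real
  assume "f \<in> entire_functions" "g \<in> entire_functions" and e: "e > 0"
    and le: "\<And>z. z \<in> cball a 1 \<Longrightarrow> norm (f z - g z) \<le> e"
  then have fg: "f holomorphic_on UNIV" "g holomorphic_on UNIV" by (auto simp: entire_iff)
  then have h: "(\<lambda>z. f z - g z) holomorphic_on UNIV" by (intro holomorphic_intros)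
  have "norm ((deriv ^^ j) (\<lambda>z. f z - g z) a) \<le> fact j * e / 1 ^ j"
    by (rule Cauchy_inequality)
       (use h le in \<open>auto intro: holomorphic_on_subset holomorphic_on_imp_continuous_on simp: dist_norm\<close>)
  then show "norm ((deriv ^^ j) f a - (deriv ^^ j) g a) \<le> fact j * e"
    using higher_deriv_diff[OF fg open_UNIV, of a j] by simp
qed auto

lemma closedin_variety_space: "closedin entire_topology (variety_space W)"
proof -
  let ?A = "\<lambda>(l, j). {f \<in> entire_functions. (deriv ^^ j) f l = 0}"
  let ?I = "{(l, j). \<exists>m. (l, m) \<in> W \<and> j < m}"
  \<comment> \<open>The whole space is inserted so that the intersection is right even when there
    are no conditions.\<close>
  have "closedin entire_topology (\<Inter> (insert entire_functions (?A ` ?I)))"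
    using closedin_deriv_zero closedin_topspace[of entire_topology] by (intro closedin_Inter) auto
  also have "\<Inter> (insert entire_functions (?A ` ?I)) = variety_space W"
    unfolding variety_space_def by fastforce
  finally show ?thesis .
qed

lemma entire_subspace_variety_space: "entire_subspace (variety_space W)"
  unfolding entire_subspace_def
proof (intro conjI ballI allI)
  have "(deriv ^^ j) (\<lambda>_::complex. 0::complex) = (\<lambda>_. 0)" for j by (induction j) auto
  then show "(\<lambda>_. 0) \<in> variety_space W" by (simp add: variety_space_def entire_iff)
  fix f g assume "f \<in> variety_space W" "g \<in> variety_space W"
  then show "(\<lambda>z. f z + g z) \<in> variety_space W"
    by (auto simp: variety_space_def entire_iff split_beta higher_deriv_add[OF _ _ open_UNIV UNIV_I]
        intro!: holomorphic_intros)
next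
  fix c f assume "f \<in> variety_space W"
  then show "(\<lambda>z. c * f z) \<in> variety_space W"
    by (auto simp: variety_space_def entire_iff split_beta higher_deriv_cmult[OF _ UNIV_I open_UNIV]
        intro!: holomorphic_intros)
qed (auto simp: variety_space_def)

lemma mem_variety_space_iff:
  "f \<in> variety_space W \<longleftrightarrow> f holomorphic_on UNIV \<and> (\<forall>(l, m)\<in>W. enat m \<le> zero_mult l f)"
  by (auto simp: variety_space_def entire_iff enat_le_zero_mult_iff_deriv)

text \<open>By \<open>variety_le\<close> the function g0 lies in S(W), hence so does z D f = f -
  f(0) g0. All points of W differ from 0 because g0(0) = 1, so the factor z carries none of the
  required multiplicity. The constant 1 is outside S(W).\<close>

lemma proper_closed_invariant_variety_space:
  assumes g0: "g0 holomorphic_on UNIV" "g0 0 = 1"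
    and W: "multiple_variety W" "W \<noteq> {}" "variety_le W (variety_of_fun g0)"
  shows "proper_closed_invariant g0 (variety_space W)"
proof -
  have zeros: "g0 l = 0 \<and> enat m \<le> zero_mult l g0" if "(l, m) \<in> W" for l m
  proof -
    have "l \<in> fst ` variety_of_fun g0"
      using that W(3) unfolding variety_le_def by force
    then obtain k where k: "(l, k) \<in> variety_of_fun g0" by auto
    then have "m \<le> k" using that W(3) by (auto simp: variety_le_def)
    then have "enat m \<le> enat k" by simp
    then show ?thesis using k by (auto simp: variety_of_fun_def simp del: enat_ord_simps)
  qed
  have g0V: "g0 \<in> variety_space W" using g0(1) zeros by (auto simp: mem_variety_space_iff)
  obtain l m where lm: "(l, m) \<in> W" using W(2) by auto
  then have "m \<ge> 1" using W(1) by (auto simp: multiple_variety_def)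
  then have "(\<lambda>_. 1) \<notin> variety_space W"
    using lm by (auto simp: variety_space_def intro!: bexI[of _ "(l, m)"] exI[of _ 0])
  moreover have "(\<lambda>_. 1) \<in> entire_functions" by (simp add: entire_iff)
  moreover have "pommiez g0 f \<in> variety_space W" if f: "f \<in> variety_space W" for f
    unfolding mem_variety_space_iff
  proof (intro conjI ballI, goal_cases)
    case 1
    show ?case using pommiez_holomorphic g0 f by (auto simp: mem_variety_space_iff)
  next
    case (2 lm)
    obtain l m where lm: "lm = (l, m)" "(l, m) \<in> W" using 2 by (cases lm) auto
    have D: "pommiez g0 f holomorphic_on UNIV"
      using pommiez_holomorphic g0 f by (auto simp: mem_variety_space_iff)
    have l0: "l \<noteq> 0" using zeros[OF lm(2)] g0(2) by auto
    have "(\<lambda>z. f 0 * g0 z) \<in> variety_space W"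
      using g0V entire_subspace_variety_space by (auto simp: entire_subspace_def)
    then have "(\<lambda>z. f z - f 0 * g0 z) \<in> variety_space W"
      by (rule entire_subspace_diff[OF entire_subspace_variety_space f])
    then have "enat m \<le> zero_mult l (\<lambda>z. z * pommiez g0 f z)"
      using lm(2) by (auto simp: mem_variety_space_iff times_pommiez[of g0, OF g0(2)])
    also have "\<dots> = zero_mult l (\<lambda>z. z) + zero_mult l (pommiez g0 f)"
      by (rule zero_mult_mult[OF holomorphic_on_ident D])
    also have "zero_mult l (\<lambda>z. z) = 0" using l0 by (subst zero_mult_eq_0) auto
    finally show ?case by (simp add: lm)
  qed
  ultimately show ?thesis
    unfolding proper_closed_invariant_def
    using entire_subspace_variety_space closedin_variety_space g0V g0(2) by fastforce
qed

section \<open>Polynomial multiples as kernels of iterated backward shifts\<close>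

lemma iterated_pommiez_holomorphic:
  assumes "e holomorphic_on UNIV" "f holomorphic_on UNIV" "e 0 = 1"
  shows "(pommiez e ^^ k) f holomorphic_on UNIV"
  using assms by (induction k) (auto intro: pommiez_holomorphic)

text \<open>The division by z is harmless on the circle of radius r >= 1, and the maximum principle
  carries the estimate inside, where z may be 0. In 1 + M the two terms stem from f - g and from
  (f(0) - g(0)) e.\<close>

lemma pommiez_bound:
  assumes e: "e holomorphic_on UNIV" "e 0 = 1" and r: "r \<ge> 1"
  shows "\<exists>C. \<forall>f g d. f holomorphic_on UNIV \<and> g holomorphic_on UNIV \<and>
       (\<forall>z\<in>cball 0 r. norm (f z - g z) \<le> d) \<longrightarrow>
       (\<forall>z\<in>cball 0 r. norm (pommiez e f z - pommiez e g z) \<le> C * d)"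
proof -
  have "compact (e ` cball 0 r)"
    using e(1) by (intro compact_continuous_image) (auto intro: holomorphic_on_imp_continuous_on holomorphic_on_subset)
  then obtain M where M: "M > 0" "\<And>z. z \<in> cball 0 r \<Longrightarrow> norm (e z) \<le> M"
    using bounded_pos[of "e ` cball 0 r"] compact_imp_bounded by (metis imageI)
  show ?thesis
  proof (intro exI[of _ "1 + M"] allI impI ballI, elim conjE)
    fix f g :: "complex \<Rightarrow> complex" and d :: real and z :: complex
    assume fg: "f holomorphic_on UNIV" "g holomorphic_on UNIV"
      and d': "\<forall>z\<in>cball 0 r. norm (f z - g z) \<le> d" and z: "z \<in> cball 0 r"
    have d: "norm (f z - g z) \<le> d" if "z \<in> cball 0 r" for z using d' that by blast
    define D where "D z = pommiez e f z - pommiez e g z" for z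
    have Dh: "D holomorphic_on UNIV"
      unfolding D_def using fg e by (intro holomorphic_intros pommiez_holomorphic)
    show "norm (pommiez e f z - pommiez e g z) \<le> (1 + M) * d"
      unfolding D_def[symmetric]
    proof (rule maximum_modulus_frontier[of D "cball 0 r"])
      fix w :: complex assume "w \<in> frontier (cball 0 r)"
      then have w: "norm w = r" by auto
      have "w * D w = (f w - g w) - (f 0 - g 0) * e w"
        using times_pommiez[of e w f, OF e(2)] times_pommiez[of e w g, OF e(2)] by (simp add: D_def algebra_simps)
      then have "norm w * norm (D w) = norm ((f w - g w) - (f 0 - g 0) * e w)"
        by (simp flip: norm_mult)
      also have "\<dots> \<le> norm (f w - g w) + norm (f 0 - g 0) * norm (e w)"
        by (metis norm_mult norm_triangle_ineq4)
      also have "\<dots> \<le> d + d * M"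
      proof -
        have "0 \<le> d" using order_trans[OF norm_ge_zero d[of 0]] r by simp
        then show ?thesis using d[of w] d[of 0] M(2)[of w] w r by (intro add_mono mult_mono) auto
      qed
      finally have "r * norm (D w) \<le> (1 + M) * d" using w by (simp add: algebra_simps)
      moreover have "norm (D w) \<le> r * norm (D w)" using r mult_right_mono[of 1 r "norm (D w)"] by simp
      ultimately show "norm (D w) \<le> (1 + M) * d" by linarith
    next
      show "D holomorphic_on interior (cball 0 r)" by (rule holomorphic_on_subset[OF Dh]) simp
      show "continuous_on (closure (cball 0 r)) D"
        by (rule holomorphic_on_imp_continuous_on[OF holomorphic_on_subset[OF Dh]]) simp
    next
      show "z \<in> cball 0 r" by (rule z)
    qed simp
  qed
qed

text \<open>The one-step bound returns to the same disc, so it can be iterated and the constants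
  multiply to C^k. The radius |z| + 1 puts z in the disc and is at least 1.\<close>

lemma closedin_iterated_pommiez_zero:
  assumes e: "e holomorphic_on UNIV" "e 0 = 1"
  shows "closedin entire_topology {f \<in> entire_functions. (pommiez e ^^ k) f z = 0}"
proof -
  define r where "r = norm z + 1"
  have r: "r \<ge> 1" by (simp add: r_def)
  obtain C where C: "\<forall>f g d. f holomorphic_on UNIV \<and> g holomorphic_on UNIV \<and>
       (\<forall>z\<in>cball 0 r. norm (f z - g z) \<le> d) \<longrightarrow>
       (\<forall>z\<in>cball 0 r. norm (pommiez e f z - pommiez e g z) \<le> C * d)"
    using pommiez_bound[OF e r] by (rule exE)
  show ?thesis
  proof (rule closedin_zero_functional[where K="cball 0 r" and C="C ^ k"])
    fix f g :: "complex \<Rightarrow> complex" and d :: real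
    assume "f \<in> entire_functions" "g \<in> entire_functions"
      and d: "\<And>z. z \<in> cball 0 r \<Longrightarrow> norm (f z - g z) \<le> d"
    then have fg: "f holomorphic_on UNIV" "g holomorphic_on UNIV" by (auto simp: entire_iff)
    have "norm ((pommiez e ^^ k) f w - (pommiez e ^^ k) g w) \<le> C ^ k * d" if "w \<in> cball 0 r" for w
      using that
    proof (induction k arbitrary: w)
      case (Suc k)
      have "norm (pommiez e ((pommiez e ^^ k) f) w - pommiez e ((pommiez e ^^ k) g) w) \<le> C * (C ^ k * d)"
        using C[rule_format, of "(pommiez e ^^ k) f" "(pommiez e ^^ k) g" "C ^ k * d" w] Suc.prems Suc.IH
          iterated_pommiez_holomorphic[OF e(1) _ e(2)] fg by blast
      then show ?case by (simp add: mult_ac)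
    qed (use d in simp)
    then show "norm ((pommiez e ^^ k) f z - (pommiez e ^^ k) g z) \<le> C ^ k * d" by (simp add: r_def)
  qed simp
qed

lemma times_ident_cancel:
  assumes "f holomorphic_on UNIV" "g holomorphic_on UNIV" "\<And>z. z * f z = z * g z"
  shows "f = (g :: complex \<Rightarrow> complex)"
proof (rule entire_mult_cancel_left[OF holomorphic_on_ident _ assms])
  show "(\<lambda>x::complex. x) \<noteq> (\<lambda>_. 0)" by (metis one_neq_zero)
qed

lemma pommiez_pCons:
  assumes e: "e holomorphic_on UNIV" "e 0 = 1"
  shows "pommiez e (\<lambda>z. e z * poly (pCons a q) z) = (\<lambda>z. e z * poly q z)"
proof (rule times_ident_cancel)
  have h: "(\<lambda>z. e z * poly q z) holomorphic_on UNIV" for q using e(1) by (intro holomorphic_intros)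
  show "pommiez e (\<lambda>z. e z * poly (pCons a q) z) holomorphic_on UNIV"
    by (rule pommiez_holomorphic[OF e(1) h e(2)])
  show "(\<lambda>z. e z * poly q z) holomorphic_on UNIV" by (rule h)
  show "z * pommiez e (\<lambda>z. e z * poly (pCons a q) z) z = z * (e z * poly q z)" for z
    using e(2) by (subst times_pommiez) (auto simp: algebra_simps)
qed

text \<open>The shift attached to \<open>e\<close> itself, rather than to g0, acts on e q by
  deleting the constant coefficient of q. Thus n + 1 applications kill exactly the numerators of
  degree at most n, and closedness follows from continuity.\<close>

lemma fmult_polys_upto_eq_kernel:
  assumes e: "e holomorphic_on UNIV" "e 0 = 1"
  shows "f \<in> fmult e (polys_upto n) \<longleftrightarrow> f holomorphic_on UNIV \<and> (pommiez e ^^ Suc n) f = (\<lambda>_. 0)"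
proof
  assume "f \<in> fmult e (polys_upto n)"
  then obtain q where q: "degree q \<le> n" "f = (\<lambda>z. e z * poly q z)" by (auto simp: fmult_polys_upto_iff)
  have "(pommiez e ^^ Suc n) (\<lambda>z. e z * poly q z) = (\<lambda>_. 0)"
    using q(1)
  proof (induction n arbitrary: q)
    case 0
    then obtain a where "q = pCons a 0" by (metis degree_eq_zeroE le_zero_eq)
    then show ?case using pommiez_pCons[OF e, of a 0] by simp
  next
    case (Suc n)
    obtain a p where p: "q = pCons a p" by (cases q)
    have "degree p \<le> n" using Suc.prems p by (cases "p = 0") auto
    then show ?case using Suc.IH[of p] pommiez_pCons[OF e, of a p]
      by (simp add: p funpow_Suc_right del: funpow.simps poly_pCons)
  qed
  then show "f holomorphic_on UNIV \<and> (pommiez e ^^ Suc n) f = (\<lambda>_. 0)"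
    using e(1) unfolding q(2) by (auto intro!: holomorphic_intros)
next
  assume "f holomorphic_on UNIV \<and> (pommiez e ^^ Suc n) f = (\<lambda>_. 0)"
  then show "f \<in> fmult e (polys_upto n)"
  proof (induction n arbitrary: f)
    case 0
    have "f z = e z * poly [:f 0:] z" for z
      using times_pommiez[of e z f, OF e(2)] 0 by (simp add: fun_eq_iff)
    then have "f = (\<lambda>z. e z * poly [:f 0:] z)" by (rule ext)
    moreover have "degree [:f 0:] \<le> 0" by simp
    ultimately show ?case unfolding fmult_polys_upto_iff by blast
  next
    case (Suc n)
    then have "pommiez e f \<in> fmult e (polys_upto n)"
      using pommiez_holomorphic[OF e(1) _ e(2)] by (simp add: funpow_Suc_right del: funpow.simps)
    then obtain q where q: "degree q \<le> n" "pommiez e f = (\<lambda>z. e z * poly q z)"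
      by (auto simp: fmult_polys_upto_iff)
    have "f z = e z * poly (pCons (f 0) q) z" for z
      using times_pommiez[of e z f, OF e(2)] by (simp add: q(2) algebra_simps)
    moreover have "degree (pCons (f 0) q) \<le> Suc n" using q(1) by simp
    ultimately show ?case unfolding fmult_polys_upto_iff by blast
  qed
qed

lemma closedin_fmult_polys_upto:
  assumes e: "e holomorphic_on UNIV" "e 0 = 1"
  shows "closedin entire_topology (fmult e (polys_upto n))"
proof -
  have "closedin entire_topology (\<Inter>z. {f \<in> entire_functions. (pommiez e ^^ Suc n) f z = 0})"
    by (intro closedin_INT closedin_iterated_pommiez_zero e) auto
  also have "(\<Inter>z. {f \<in> entire_functions. (pommiez e ^^ Suc n) f z = 0}) = fmult e (polys_upto n)"
    using fmult_polys_upto_eq_kernel[OF e, of _ n] by (auto simp: entire_iff fun_eq_iff)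
  finally show ?thesis .
qed

lemma entire_subspace_fmult_polys_upto:
  assumes e: "e holomorphic_on UNIV"
  shows "entire_subspace (fmult e (polys_upto n))"
  unfolding entire_subspace_def
proof (intro conjI ballI allI)
  show "fmult e (polys_upto n) \<subseteq> entire_functions"
    using e by (auto simp: fmult_polys_upto_iff entire_iff intro!: holomorphic_intros)
  show "(\<lambda>_. 0) \<in> fmult e (polys_upto n)"
    unfolding fmult_polys_upto_iff by (intro exI[of _ 0]) auto
  fix f g assume "f \<in> fmult e (polys_upto n)" "g \<in> fmult e (polys_upto n)"
  then obtain p q where "degree p \<le> n" "degree q \<le> n" "f = (\<lambda>z. e z * poly p z)" "g = (\<lambda>z. e z * poly q z)"
    by (auto simp: fmult_polys_upto_iff)
  then show "(\<lambda>z. f z + g z) \<in> fmult e (polys_upto n)"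
    unfolding fmult_polys_upto_iff
    by (intro exI[of _ "p + q"]) (auto intro: degree_add_le simp: algebra_simps)
next
  fix c f assume "f \<in> fmult e (polys_upto n)"
  then obtain p where "degree p \<le> n" "f = (\<lambda>z. e z * poly p z)"
    by (auto simp: fmult_polys_upto_iff)
  then show "(\<lambda>z. c * f z) \<in> fmult e (polys_upto n)"
    unfolding fmult_polys_upto_iff
    by (intro exI[of _ "smult c p"]) (auto intro: order_trans[OF degree_smult_le] simp: algebra_simps)
qed

text \<open>Under the shift attached to g0 the numerator q becomes r with z r = q - q(0) p. The
  right side has degree at most n + 1 by the bound on deg p, so r has degree at most n. The function
  e z^(n+1) shows that the space is not everything.\<close>

lemma proper_closed_invariant_fmult_polys_upto:
  assumes g0: "g0 holomorphic_on UNIV" "g0 0 = 1"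
    and p: "p \<in> entire_denominators g0" and n: "int n \<ge> int (degree p) - 1"
  shows "proper_closed_invariant g0 (fmult (quot g0 p) (polys_upto n))"
proof -
  define e where "e = quot g0 p"
  have e: "e holomorphic_on UNIV" "poly p 0 = 1" "\<And>z. g0 z = e z * poly p z"
    using entire_denominatorsD[OF g0(1) p] unfolding e_def by blast+
  have e0: "e 0 = 1" using e(2) e(3)[of 0] g0(2) by simp
  let ?S = "fmult e (polys_upto n)"
  have "e \<in> ?S" unfolding fmult_polys_upto_iff by (intro exI[of _ 1]) auto
  then have "?S \<noteq> {\<lambda>_. 0}" using e0 by auto
  moreover have "?S \<noteq> entire_functions"
  proof
    assume eq: "?S = entire_functions"
    have "(\<lambda>z. e z * poly (monom 1 (Suc n)) z) \<in> entire_functions"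
      using e(1) unfolding entire_iff by (intro holomorphic_intros)
    then obtain q where q: "degree q \<le> n"
      "(\<lambda>z. e z * poly (monom 1 (Suc n)) z) = (\<lambda>z. e z * poly q z)"
      unfolding eq[symmetric] fmult_polys_upto_iff by blast
    have "poly (monom 1 (Suc n)) = poly q"
      by (rule entire_mult_cancel_left[OF e(1)])
         (use e0 fun_cong[OF q(2)] in \<open>auto intro!: holomorphic_intros simp del: monom_Suc\<close>)
    then have "monom 1 (Suc n) = q" by (simp only: poly_eq_poly_eq_iff)
    with q(1) show False by (auto simp: degree_monom_eq)
  qed
  moreover have "pommiez g0 f \<in> ?S" if f: "f \<in> ?S" for f
  proof -
    obtain q where q: "degree q \<le> n" "f = (\<lambda>z. e z * poly q z)" using f by (auto simp: fmult_polys_upto_iff)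
    have "poly (q - smult (poly q 0) p) 0 = 0" using e(2) by simp
    then obtain r where r: "q - smult (poly q 0) p = pCons 0 r"
      by (metis pCons_cases poly_pCons add.right_neutral mult_zero_left)
    have "degree (pCons 0 r) \<le> Suc n"
      unfolding r[symmetric] using q(1) n
      by (intro degree_diff_le) (auto intro: order_trans[OF degree_smult_le])
    then have dr: "degree r \<le> n" by (cases "r = 0") auto
    have "pommiez g0 f = (\<lambda>z. e z * poly r z)"
    proof (rule times_ident_cancel)
      have fh: "f holomorphic_on UNIV" unfolding q(2) using e(1) by (intro holomorphic_intros)
      show "pommiez g0 f holomorphic_on UNIV" by (rule pommiez_holomorphic[OF g0(1) fh g0(2)])
      show "(\<lambda>z. e z * poly r z) holomorphic_on UNIV" using e(1) by (intro holomorphic_intros)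
      fix z
      have "z * poly r z = poly q z - poly q 0 * poly p z"
        using arg_cong[OF r, of "\<lambda>p. poly p z"] by simp
      moreover have "z * pommiez g0 f z = e z * (poly q z - poly q 0 * poly p z)"
        using times_pommiez[of g0 z f, OF g0(2)] e0 by (simp add: q(2) e(3) algebra_simps)
      ultimately show "z * pommiez g0 f z = z * (e z * poly r z)" by simp
    qed
    with dr show ?thesis by (auto simp: fmult_polys_upto_iff)
  qed
  ultimately show ?thesis
    unfolding proper_closed_invariant_def e_def[symmetric]
    using entire_subspace_fmult_polys_upto[OF e(1)] closedin_fmult_polys_upto[OF e(1) e0] by auto
qed

theorem mainTheorem3:
  fixes g0 :: "complex \<Rightarrow> complex"
  assumes "g0 \<in> entire_functions" and "g0 0 = 1"
  shows "((\<forall>z. g0 z \<noteq> 0) \<longrightarrow>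
            (\<forall>n. proper_closed_invariant g0 (fmult g0 (polys_upto n))) \<and>
            (\<forall>S. proper_closed_invariant g0 S \<longrightarrow>
                 S \<subseteq> fmult g0 polys \<and> S = fmult g0 (polys_upto (nS g0 S)))) \<and>
         ((\<exists>z. g0 z = 0) \<longrightarrow>
            (\<forall>W. multiple_variety W \<and> W \<noteq> {} \<and> variety_le W (variety_of_fun g0) \<longrightarrow>
                 proper_closed_invariant g0 (variety_space W)) \<and>
            (\<forall>p n. p \<in> entire_denominators g0 \<and> int n \<ge> int (degree p) - 1 \<longrightarrow>
                 proper_closed_invariant g0 (fmult (quot g0 p) (polys_upto n))) \<and>
            (\<forall>S. proper_closed_invariant g0 S \<longrightarrow>
                 S = variety_space (variety_of_set S) \<or>
                 S \<subseteq> rational_multiples g0 \<and>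
                 S = fmult (quot g0 (pS g0 S)) (polys_upto (nS g0 S))))"
proof -
  have g0: "g0 holomorphic_on UNIV" "g0 0 = 1" using assms by (auto simp: entire_iff)
  \<comment> \<open>With p = 1 statement (i) becomes an instance of (iv), which is proved without
    reference to zeros of g0.\<close>
  have 1: "1 \<in> entire_denominators g0" "quot g0 1 = g0"
    using entire_denominatorsI[of 1 g0 g0] g0 by auto
  have inv: "pommiez_invariant g0 S" if "proper_closed_invariant g0 S" for S
    using g0 that by unfold_locales
  have i: "proper_closed_invariant g0 (fmult g0 (polys_upto n))" for n
    using proper_closed_invariant_fmult_polys_upto[OF g0 1(1), of n] by (simp add: 1(2))
  show ?thesis
  proof (intro conjI impI allI)
    assume nz: "\<forall>z. g0 z \<noteq> 0"
    show "proper_closed_invariant g0 (fmult g0 (polys_upto n))" for n by (rule i)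
    fix S assume "proper_closed_invariant g0 S"
    from pommiez_invariant.zero_free_case[OF inv[OF this]] nz
    show "S \<subseteq> fmult g0 polys" "S = fmult g0 (polys_upto (nS g0 S))" by blast+
  next
    fix W assume "multiple_variety W \<and> W \<noteq> {} \<and> variety_le W (variety_of_fun g0)"
    then show "proper_closed_invariant g0 (variety_space W)"
      using proper_closed_invariant_variety_space[OF g0] by blast
  next
    fix p n assume "p \<in> entire_denominators g0 \<and> int n \<ge> int (degree p) - 1"
    then show "proper_closed_invariant g0 (fmult (quot g0 p) (polys_upto n))"
      using proper_closed_invariant_fmult_polys_upto[OF g0] by blast
  next
    fix S assume "proper_closed_invariant g0 S"
    from pommiez_invariant.dichotomy[OF inv[OF this]]
    show "S = variety_space (variety_of_set S) \<or>
        S \<subseteq> rational_multiples g0 \<and> S = fmult (quot g0 (pS g0 S)) (polys_upto (nS g0 S))" .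
  qed
qed

end
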